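(* Let $\mathcal E$ be a regular Dirichlet form on $L^2(X,m)$. If $\varrho$ is an intrinsic metric for $\mathcal E$, then $$M:=\{f:X\to\mathbb R\ :\ |f(x)-f(y)|\le\varrho(x,y)\ \text{for all }x,y\in X\}$$ is a set of intrinsic-metric functions, and $\varrho^{(M)}=\varrho$. Conversely, if $M$ is an arbitrary set of intrinsic-metric functions, then $\varrho^{(M)}$ is an intrinsic metric for $\mathcal E$.
   Context: Setting. $X$ is a locally compact separable metric space, $m$ a positive Radon measure on $X$ with $\operatorname{supp} m=X$; all functions are real valued; $C(X)$ denotes the continuous functions and $C_c(X)$ the continuous compactly supported functions. $\mathcal E:\mathcal D\times\mathcal D\to\mathbb R$, with $\mathcal D$ dense in $L^2(X,m)$, is a regular (symmetric) Dirichlet form: it is closed, non-negative, $\mathcal E(T\circ u,T\circ u)\le\mathcal E(u,u)$ for all normal contractions $T$, and $\mathcal D\cap C_c(X)$ is dense in $\mathcal D$ with respect to $\sqrt{\mathcal E_1}$, where $\mathcal E_1(u,u)=\mathcal E(u,u)+\|u\|_{L^2}^2$, and dense in $C_c(X)$ with respect to $\|\cdot\|_\infty$. For bilinear $q$ write $q(u):=q(u,u)$. $\tilde u$ denotes a quasi-continuous representative of $u$ (with respect to the capacity of $\mathcal E$); it exists for $u\in\mathcal D$ and $u\in\mathcal D_{loc}$ (below). Beurling–Deny formula: with $d=\{(x,x):x\in X\}$, there are a non-negative Radon measure $k$ on $X$, a non-negative symmetric Radon measure $J$ on $X\times X\setminus d$, and a positive semidefinite bilinear form $\mu^{(c)}$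 on $\mathcal D$ with values in the signed Radon measures on $X$, strongly local (i.e. $\mu^{(c)}(u,v)=0$ if $u$ is constant on $\operatorname{supp}v$), such that for $u\in\mathcal D$ $$\mathcal E(u)=\int_{X\times X\setminus d}(\tilde u(x)-\tilde u(y))^2\,J(dx,dy)+\int_X d\mu^{(c)}(u)+\int_X\tilde u^2\,dk.$$ Local spaces: $\mathcal D_{loc}$ is the set of $u\in L^2_{loc}$ such that for every open relatively compact $G\subset X$ there is $v\in\mathcal D$ with $u=v$ on $G$. $\mathcal D_{loc}^*$ is the set of $u\in\mathcal D_{loc}$ with $\int_{K\times X\setminus d}(\tilde u(x)-\tilde u(y))^2J(dx,dy)<\infty$ for all compact $K\subset X$. $\mu^{(c)}$ is extended to $\mathcal D_{loc}$ by locality. For $u\in\mathcal D_{loc}^*$ put $\mu^{(b)}(u)(E)=\int_{E\times X\setminus d}(\tilde u(x)-\tilde u(y))^2J(dx,dy)$ for measurable $E\subset X$. A pseudo-metric is a map $\varrho:X\times X\to[0,\infty]$ with $\varrho(x,x)=0$, symmetric, satisfying the triangle inequality; $\varrho_A(x):=\inf_{y\in A}\varrho(x,y)$. A pseudo-metric $\varrho$ is an intrinsic metric for $\mathcal E$ if there are Radon measures $m_b,m_c$ with $m_b+m_c\le m$ such that for all $A\subset X$ and all $T>0$: $\varrho_A\wedge T\in\mathcal D_{loc}^*\cap C(X)$, $\mu^{(b)}(\varrho_A\wedge T)\le m_b$ and $\mu^{(c)}(\varrho_A\wedge T)\le m_c$. A set $M\subset\mathcal D_{loc}^*\cap C(X)$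 is called a set of intrinsic-metric functions if there are Radon measures $m_b,m_c$ with $m_b+m_c\le m$ such that: $0\in M$; $\mu^{(b)}(f)\le m_b$ and $\mu^{(c)}(f)\le m_c$ for all $f\in M$; $f+c\in M$ and $-f\in M$ for all $c\in\mathbb R$, $f\in M$; and $\sup_i f_i\in M$ whenever $f_i\in M$ ($i\in\mathbb N$) and $\sup_i f_i$ is finite. For such $M$ define $\varrho^{(M)}(x,y):=\sup\{f(x): f\in M,\ f(y)=0\}$. *)

theory Defs
  imports "HOL-Analysis.Analysis"
begin

section \<open>Regular Dirichlet forms\<close>

text \<open>
  The space \<open>X\<close> is a type \<open>'a\<close> of class \<open>metric_space\<close> and \<open>second_countable_topology\<close>; for metric
  spaces second countability is separability.  Elements of \<open>L\<^sup>2(X,m)\<close> are represented by Borel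
  functions; sets of such functions are closed under a.e. equality where this matters.
\<close>

text \<open>
  On a locally compact separable metric space a Borel measure that is finite on compact sets is
  automatically regular.
\<close>
definition radon_measure :: "'a::topological_space measure \<Rightarrow> bool" where
  "radon_measure \<nu> \<longleftrightarrow> sets \<nu> = sets borel \<and> (\<forall>K. compact K \<longrightarrow> emeasure \<nu> K < \<infinity>)"

definition full_support :: "'a::topological_space measure \<Rightarrow> bool" where
  "full_support m \<longleftrightarrow> (\<forall>U. open U \<longrightarrow> U \<noteq> {} \<longrightarrow> emeasure m U > 0)"

definition L2 :: "'a measure \<Rightarrow> ('a \<Rightarrow> real) set" where
  "L2 m = {f \<in> borel_measurable m. integrable m (\<lambda>x. (f x)\<^sup>2)}"

definition L2_loc :: "'a::topological_space measure \<Rightarrow> ('a \<Rightarrow> real) set" where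
  "L2_loc m = {f \<in> borel_measurable m. \<forall>K. compact K \<longrightarrow> set_integrable m K (\<lambda>x. (f x)\<^sup>2)}"

definition C_c :: "('a::topological_space \<Rightarrow> real) set" where
  "C_c = {f. continuous_on UNIV f \<and> compact (closure {x. f x \<noteq> 0})}"

definition normal_contraction :: "(real \<Rightarrow> real) \<Rightarrow> bool" where
  "normal_contraction T \<longleftrightarrow> T 0 = 0 \<and> (\<forall>s t. \<bar>T s - T t\<bar> \<le> \<bar>s - t\<bar>)"

definition E1 :: "'a measure \<Rightarrow> (('a \<Rightarrow> real) \<Rightarrow> ('a \<Rightarrow> real) \<Rightarrow> real) \<Rightarrow> ('a \<Rightarrow> real) \<Rightarrow> real" where
  "E1 m E u = E u u + (\<integral>x. (u x)\<^sup>2 \<partial>m)"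

text \<open>A symmetric bilinear form on a dense subspace of \<open>L\<^sup>2\<close>, well defined on a.e. classes.\<close>
definition symmetric_form ::
  "'a measure \<Rightarrow> ('a \<Rightarrow> real) set \<Rightarrow> (('a \<Rightarrow> real) \<Rightarrow> ('a \<Rightarrow> real) \<Rightarrow> real) \<Rightarrow> bool" where
  "symmetric_form m D E \<longleftrightarrow>
     D \<subseteq> L2 m \<and>
     (\<lambda>x. 0) \<in> D \<and>
     (\<forall>u\<in>D. \<forall>v\<in>D. (\<lambda>x. u x + v x) \<in> D) \<and>
     (\<forall>c. \<forall>u\<in>D. (\<lambda>x. c * u x) \<in> D) \<and>
     (\<forall>u\<in>D. \<forall>v\<in>borel_measurable m. (AE x in m. u x = v x) \<longrightarrow> v \<in> D) \<and>
     (\<forall>f\<in>L2 m. \<forall>e>0. \<exists>u\<in>D. (\<integral>x. (f x - u x)\<^sup>2 \<partial>m) < e) \<and>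
     (\<forall>u\<in>D. \<forall>v\<in>D. E u v = E v u) \<and>
     (\<forall>u\<in>D. \<forall>v\<in>D. \<forall>w\<in>D. E (\<lambda>x. u x + v x) w = E u w + E v w) \<and>
     (\<forall>c. \<forall>u\<in>D. \<forall>w\<in>D. E (\<lambda>x. c * u x) w = c * E u w) \<and>
     (\<forall>u\<in>D. \<forall>v\<in>D. \<forall>w\<in>D. (AE x in m. u x = v x) \<longrightarrow> E u w = E v w)"

definition dirichlet_form ::
  "'a measure \<Rightarrow> ('a \<Rightarrow> real) set \<Rightarrow> (('a \<Rightarrow> real) \<Rightarrow> ('a \<Rightarrow> real) \<Rightarrow> real) \<Rightarrow> bool" where
  "dirichlet_form m D E \<longleftrightarrow>
     symmetric_form m D E \<and>
     (\<forall>u\<in>D. 0 \<le> E u u) \<and>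
     \<comment> \<open>closedness: \<open>D\<close> is complete with respect to the norm given by \<open>E1\<close>\<close>
     (\<forall>u. (\<forall>n::nat. u n \<in> D) \<longrightarrow>
          (\<forall>e>0. \<exists>N. \<forall>i\<ge>N. \<forall>j\<ge>N. E1 m E (\<lambda>x. u i x - u j x) < e) \<longrightarrow>
          (\<exists>v\<in>D. (\<lambda>n. E1 m E (\<lambda>x. u n x - v x)) \<longlonglongrightarrow> 0)) \<and>
     (\<forall>T. normal_contraction T \<longrightarrow> (\<forall>u\<in>D. T \<circ> u \<in> D \<and> E (T \<circ> u) (T \<circ> u) \<le> E u u))"

definition regular_dirichlet_form ::
  "'a::topological_space measure \<Rightarrow> ('a \<Rightarrow> real) set \<Rightarrow>
     (('a \<Rightarrow> real) \<Rightarrow> ('a \<Rightarrow> real) \<Rightarrow> real) \<Rightarrow> bool" where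
  "regular_dirichlet_form m D E \<longleftrightarrow>
     dirichlet_form m D E \<and>
     (\<forall>u\<in>D. \<forall>e>0. \<exists>v\<in>D \<inter> C_c. sqrt (E1 m E (\<lambda>x. u x - v x)) < e) \<and>
     (\<forall>f\<in>C_c. \<forall>e>0. \<exists>v\<in>D \<inter> C_c. \<forall>x. \<bar>f x - v x\<bar> < e)"


section \<open>Capacity and quasi-continuous representatives\<close>

text \<open>The infimum over the empty set is \<open>\<infinity>\<close>.\<close>
definition capacity_open ::
  "'a measure \<Rightarrow> ('a \<Rightarrow> real) set \<Rightarrow> (('a \<Rightarrow> real) \<Rightarrow> ('a \<Rightarrow> real) \<Rightarrow> real) \<Rightarrow> 'a set \<Rightarrow> ennreal" where
  "capacity_open m D E U = (INF v\<in>{v\<in>D. AE x in m. x \<in> U \<longrightarrow> 1 \<le> v x}. ennreal (E1 m E v))"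

definition quasi_continuous ::
  "'a::topological_space measure \<Rightarrow> ('a \<Rightarrow> real) set \<Rightarrow> (('a \<Rightarrow> real) \<Rightarrow> ('a \<Rightarrow> real) \<Rightarrow> real) \<Rightarrow>
     ('a \<Rightarrow> real) \<Rightarrow> bool" where
  "quasi_continuous m D E u \<longleftrightarrow>
     (\<forall>e>0. \<exists>U. open U \<and> capacity_open m D E U < ennreal e \<and> continuous_on (- U) u)"

text \<open>
  The representative \<open>u\<^sup>~\<close>.  Quasi-continuous representatives are unique up to sets of capacity zero,
  which are not charged by the measures they are integrated against; any choice is allowed.  The
  choice made here keeps a Borel function that already is quasi-continuous (e.g. a continuous one).
\<close>
definition qc_rep ::
  "'a::topological_space measure \<Rightarrow> ('a \<Rightarrow> real) set \<Rightarrow> (('a \<Rightarrow> real) \<Rightarrow> ('a \<Rightarrow> real) \<Rightarrow> real) \<Rightarrow>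
     ('a \<Rightarrow> real) \<Rightarrow> ('a \<Rightarrow> real)" where
  "qc_rep m D E u =
     (if u \<in> borel_measurable borel \<and> quasi_continuous m D E u then u
      else (SOME v. v \<in> borel_measurable borel \<and> quasi_continuous m D E v \<and> (AE x in m. u x = v x)))"


section \<open>Beurling--Deny decomposition\<close>

abbreviation diag :: "('a \<times> 'a) set" where
  "diag \<equiv> {(x, y). x = y}"

text \<open>
  Radon measures on \<open>X \<times> X \<setminus> d\<close> are encoded as Borel measures on \<open>X \<times> X\<close> that
  vanish on the diagonal \<open>d\<close>; they may have infinite mass near \<open>d\<close>.
\<close>
definition jump_measure :: "('a::t2_space \<times> 'a) measure \<Rightarrow> bool" where
  "jump_measure J \<longleftrightarrow>
     sets J = sets borel \<and> emeasure J diag = 0 \<and>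
     (\<forall>K. compact K \<longrightarrow> K \<inter> diag = {} \<longrightarrow> emeasure J K < \<infinity>) \<and>
     (\<forall>B\<in>sets borel. emeasure J (prod.swap -` B) = emeasure J B)"

text \<open>Finite signed Borel measures, as set functions on the Borel sets.\<close>
definition signed_measure :: "('a::topological_space set \<Rightarrow> real) \<Rightarrow> bool" where
  "signed_measure \<nu> \<longleftrightarrow>
     (\<forall>B. range B \<subseteq> sets borel \<longrightarrow> disjoint_family B \<longrightarrow> (\<lambda>n::nat. \<nu> (B n)) sums \<nu> (\<Union>n. B n))"

text \<open>The support of the measure \<open>\<bar>v\<bar> m\<close>.\<close>
definition supp :: "'a::topological_space measure \<Rightarrow> ('a \<Rightarrow> real) \<Rightarrow> 'a set" where
  "supp m v = {x. \<forall>U. open U \<longrightarrow> x \<in> U \<longrightarrow> \<not> (AE y in m. y \<in> U \<longrightarrow> v y = 0)}"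

text \<open>
  The strongly local measure-valued form \<open>\<mu>\<^sup>c\<close>.  By the Beurling--Deny formula \<open>\<mu>\<^sup>c(u,u)(X)\<close> is
  finite, so that all its values are finite signed measures.  The last clause is the locality that
  makes the extension of \<open>\<mu>\<^sup>c\<close> to \<open>D_loc\<close> well defined; the vanishing of the whole measure
  \<open>\<mu>\<^sup>c(u,v)\<close> in the clause before it does not imply it.
\<close>
definition strongly_local_energy_form ::
  "'a::topological_space measure \<Rightarrow> ('a \<Rightarrow> real) set \<Rightarrow>
     (('a \<Rightarrow> real) \<Rightarrow> ('a \<Rightarrow> real) \<Rightarrow> 'a set \<Rightarrow> real) \<Rightarrow> bool" where
  "strongly_local_energy_form m D \<mu>c \<longleftrightarrow>
     (\<forall>u\<in>D. \<forall>v\<in>D. signed_measure (\<mu>c u v)) \<and>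
     (\<forall>u\<in>D. \<forall>v\<in>D. \<forall>B\<in>sets borel. \<mu>c u v B = \<mu>c v u B) \<and>
     (\<forall>u\<in>D. \<forall>v\<in>D. \<forall>w\<in>D. \<forall>B\<in>sets borel. \<mu>c (\<lambda>x. u x + v x) w B = \<mu>c u w B + \<mu>c v w B) \<and>
     (\<forall>c. \<forall>u\<in>D. \<forall>w\<in>D. \<forall>B\<in>sets borel. \<mu>c (\<lambda>x. c * u x) w B = c * \<mu>c u w B) \<and>
     (\<forall>u\<in>D. \<forall>B\<in>sets borel. 0 \<le> \<mu>c u u B) \<and>
     (\<forall>u\<in>D. \<forall>v\<in>D. (\<exists>c. AE x in m. x \<in> supp m v \<longrightarrow> u x = c) \<longrightarrow>
        (\<forall>B\<in>sets borel. \<mu>c u v B = 0)) \<and>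
     (\<forall>u\<in>D. \<forall>v\<in>D. \<forall>G. open G \<longrightarrow> (AE x in m. x \<in> G \<longrightarrow> u x = v x) \<longrightarrow>
        (\<forall>B\<in>sets borel. B \<subseteq> G \<longrightarrow> \<mu>c u u B = \<mu>c v v B))"

definition beurling_deny ::
  "'a::t2_space measure \<Rightarrow> ('a \<Rightarrow> real) set \<Rightarrow> (('a \<Rightarrow> real) \<Rightarrow> ('a \<Rightarrow> real) \<Rightarrow> real) \<Rightarrow>
     ('a \<times> 'a) measure \<Rightarrow> 'a measure \<Rightarrow>
     (('a \<Rightarrow> real) \<Rightarrow> ('a \<Rightarrow> real) \<Rightarrow> 'a set \<Rightarrow> real) \<Rightarrow> bool" where
  "beurling_deny m D E J k \<mu>c \<longleftrightarrow>
     jump_measure J \<and> radon_measure k \<and> strongly_local_energy_form m D \<mu>c \<and>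
     (\<forall>u\<in>D. ennreal (E u u) =
        (\<integral>\<^sup>+(x, y)\<in>- diag. ennreal ((qc_rep m D E u x - qc_rep m D E u y)\<^sup>2) \<partial>J)
        + ennreal (\<mu>c u u UNIV)
        + (\<integral>\<^sup>+x. ennreal ((qc_rep m D E u x)\<^sup>2) \<partial>k))"


section \<open>Local spaces and energy measures\<close>

definition D_loc :: "'a::topological_space measure \<Rightarrow> ('a \<Rightarrow> real) set \<Rightarrow> ('a \<Rightarrow> real) set" where
  "D_loc m D = {u \<in> L2_loc m. \<forall>G. open G \<longrightarrow> compact (closure G) \<longrightarrow>
      (\<exists>v\<in>D. AE x in m. x \<in> G \<longrightarrow> u x = v x)}"

definition mu_b ::
  "'a::t2_space measure \<Rightarrow> ('a \<Rightarrow> real) set \<Rightarrow> (('a \<Rightarrow> real) \<Rightarrow> ('a \<Rightarrow> real) \<Rightarrow> real) \<Rightarrow>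
     ('a \<times> 'a) measure \<Rightarrow> ('a \<Rightarrow> real) \<Rightarrow> 'a set \<Rightarrow> ennreal" where
  "mu_b m D E J u B =
     (\<integral>\<^sup>+(x, y)\<in>B \<times> UNIV - diag. ennreal ((qc_rep m D E u x - qc_rep m D E u y)\<^sup>2) \<partial>J)"

definition D_loc_star ::
  "'a::t2_space measure \<Rightarrow> ('a \<Rightarrow> real) set \<Rightarrow> (('a \<Rightarrow> real) \<Rightarrow> ('a \<Rightarrow> real) \<Rightarrow> real) \<Rightarrow>
     ('a \<times> 'a) measure \<Rightarrow> ('a \<Rightarrow> real) set" where
  "D_loc_star m D E J = {u \<in> D_loc m D. \<forall>K. compact K \<longrightarrow> mu_b m D E J u K < \<infinity>}"

text \<open>The extension of \<open>u \<mapsto> \<mu>\<^sup>c(u)\<close> from \<open>D\<close> to \<open>D_loc\<close> by locality.\<close>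
definition mu_c ::
  "'a::topological_space measure \<Rightarrow> ('a \<Rightarrow> real) set \<Rightarrow>
     (('a \<Rightarrow> real) \<Rightarrow> ('a \<Rightarrow> real) \<Rightarrow> 'a set \<Rightarrow> real) \<Rightarrow> ('a \<Rightarrow> real) \<Rightarrow> 'a measure" where
  "mu_c m D \<mu>c u = (THE \<nu>. sets \<nu> = sets borel \<and>
     (\<forall>G. open G \<longrightarrow> compact (closure G) \<longrightarrow>
        (\<forall>v\<in>D. (AE x in m. x \<in> G \<longrightarrow> u x = v x) \<longrightarrow>
           (\<forall>B\<in>sets borel. B \<subseteq> G \<longrightarrow> emeasure \<nu> B = ennreal (\<mu>c v v B)))))"


section \<open>Intrinsic metrics and sets of intrinsic-metric functions\<close>

definition pseudo_metric :: "('a \<Rightarrow> 'a \<Rightarrow> ennreal) \<Rightarrow> bool" where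
  "pseudo_metric \<rho> \<longleftrightarrow>
     (\<forall>x. \<rho> x x = 0) \<and> (\<forall>x y. \<rho> x y = \<rho> y x) \<and> (\<forall>x y z. \<rho> x z \<le> \<rho> x y + \<rho> y z)"

text \<open>\<open>\<rho>\<^sub>A\<close>; in particular \<open>\<rho>\<^sub>A = \<infinity>\<close> for \<open>A = {}\<close>.\<close>
definition pm_setdist :: "('a \<Rightarrow> 'a \<Rightarrow> ennreal) \<Rightarrow> 'a set \<Rightarrow> 'a \<Rightarrow> ennreal" where
  "pm_setdist \<rho> A x = (INF y\<in>A. \<rho> x y)"

text \<open>The real-valued function \<open>\<rho>\<^sub>A \<and> T\<close>.\<close>
definition pm_setdist_cut :: "('a \<Rightarrow> 'a \<Rightarrow> ennreal) \<Rightarrow> 'a set \<Rightarrow> real \<Rightarrow> 'a \<Rightarrow> real" where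
  "pm_setdist_cut \<rho> A T x = enn2real (min (pm_setdist \<rho> A x) (ennreal T))"

definition admissible_pair ::
  "'a::topological_space measure \<Rightarrow> 'a measure \<Rightarrow> 'a measure \<Rightarrow> bool" where
  "admissible_pair m mb mc \<longleftrightarrow> radon_measure mb \<and> radon_measure mc \<and>
     (\<forall>B\<in>sets borel. emeasure mb B + emeasure mc B \<le> emeasure m B)"

definition energy_bounded ::
  "'a::t2_space measure \<Rightarrow> ('a \<Rightarrow> real) set \<Rightarrow> (('a \<Rightarrow> real) \<Rightarrow> ('a \<Rightarrow> real) \<Rightarrow> real) \<Rightarrow>
     ('a \<times> 'a) measure \<Rightarrow> (('a \<Rightarrow> real) \<Rightarrow> ('a \<Rightarrow> real) \<Rightarrow> 'a set \<Rightarrow> real) \<Rightarrow>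
     'a measure \<Rightarrow> 'a measure \<Rightarrow> ('a \<Rightarrow> real) \<Rightarrow> bool" where
  "energy_bounded m D E J \<mu>c mb mc f \<longleftrightarrow>
     (\<forall>B\<in>sets borel. mu_b m D E J f B \<le> emeasure mb B) \<and>
     (\<forall>B\<in>sets borel. emeasure (mu_c m D \<mu>c f) B \<le> emeasure mc B)"

definition intrinsic_metric ::
  "'a::t2_space measure \<Rightarrow> ('a \<Rightarrow> real) set \<Rightarrow> (('a \<Rightarrow> real) \<Rightarrow> ('a \<Rightarrow> real) \<Rightarrow> real) \<Rightarrow>
     ('a \<times> 'a) measure \<Rightarrow> (('a \<Rightarrow> real) \<Rightarrow> ('a \<Rightarrow> real) \<Rightarrow> 'a set \<Rightarrow> real) \<Rightarrow>
     ('a \<Rightarrow> 'a \<Rightarrow> ennreal) \<Rightarrow> bool" where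
  "intrinsic_metric m D E J \<mu>c \<rho> \<longleftrightarrow>
     pseudo_metric \<rho> \<and>
     (\<exists>mb mc. admissible_pair m mb mc \<and>
        (\<forall>A. \<forall>T>0. pm_setdist_cut \<rho> A T \<in> D_loc_star m D E J \<and>
           continuous_on UNIV (pm_setdist_cut \<rho> A T) \<and>
           energy_bounded m D E J \<mu>c mb mc (pm_setdist_cut \<rho> A T)))"

definition intrinsic_metric_functions ::
  "'a::t2_space measure \<Rightarrow> ('a \<Rightarrow> real) set \<Rightarrow> (('a \<Rightarrow> real) \<Rightarrow> ('a \<Rightarrow> real) \<Rightarrow> real) \<Rightarrow>
     ('a \<times> 'a) measure \<Rightarrow> (('a \<Rightarrow> real) \<Rightarrow> ('a \<Rightarrow> real) \<Rightarrow> 'a set \<Rightarrow> real) \<Rightarrow>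
     ('a \<Rightarrow> real) set \<Rightarrow> bool" where
  "intrinsic_metric_functions m D E J \<mu>c M \<longleftrightarrow>
     M \<subseteq> D_loc_star m D E J \<inter> {f. continuous_on UNIV f} \<and>
     (\<exists>mb mc. admissible_pair m mb mc \<and> (\<forall>f\<in>M. energy_bounded m D E J \<mu>c mb mc f)) \<and>
     (\<lambda>x. 0) \<in> M \<and>
     (\<forall>c. \<forall>f\<in>M. (\<lambda>x. f x + c) \<in> M) \<and>
     (\<forall>f\<in>M. (\<lambda>x. - f x) \<in> M) \<and>
     (\<forall>f. (\<forall>i::nat. f i \<in> M) \<longrightarrow> (\<forall>x. bdd_above (range (\<lambda>i. f i x))) \<longrightarrow>
        (\<lambda>x. SUP i. f i x) \<in> M)"

text \<open>
  Since \<open>ennreal\<close> maps negative numbers to \<open>0\<close>, this is the supremum of the values \<open>f x\<close> as soon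
  as \<open>0 \<in> M\<close>.
\<close>
definition metric_of :: "('a \<Rightarrow> real) set \<Rightarrow> 'a \<Rightarrow> 'a \<Rightarrow> ennreal" where
  "metric_of M x y = (SUP f\<in>{f\<in>M. f y = 0}. ennreal (f x))"

end

theory Submission
  imports Defs
begin

text \<open>
  The converse half is soft.  A family of continuous functions on a second countable space has a
  countable subfamily with the same pointwise supremum (\<open>countable_subfamily_same_supremum\<close>), so a
  set \<open>M\<close> of intrinsic-metric functions is closed under arbitrary suprema and infima that are finite.
  Since \<open>\<rho>\<^sub>A \<and> T\<close> for \<open>\<rho> = \<rho>\<^sup>M\<close> is an infimum of suprema of truncated elements of \<open>M\<close>, it belongs to
  \<open>M\<close> (\<open>cut_in_M\<close>), and the elements of \<open>M\<close> have all the required properties.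

  For the first half let \<open>f\<close> be 1-Lipschitz with respect to an intrinsic metric \<open>\<rho>\<close>.  It has to be
  shown that \<open>f\<close> is locally in the form domain, with \<open>\<mu>\<^sup>b(f) \<le> m\<^sub>b\<close> and \<open>\<mu>\<^sup>c(f) \<le> m\<^sub>c\<close>.

  The bound on the jump part does not pass to minima and maxima of functions, so it is not obtained by
  approximating \<open>f\<close>.  Instead the space is cut into countably many Borel pieces of small
  \<open>\<rho>\<close>-diameter.  For \<open>x\<close> in a piece \<open>P\<close>, the increment \<open>\<bar>f x - f y\<bar>\<close> exceeds the increment of \<open>\<rho>\<^sub>P\<close>
  by at most the diameter of \<open>P\<close>; summing \<open>\<mu>\<^sup>b(\<rho>\<^sub>P \<and> T)(P) \<le> m\<^sub>b(P)\<close> over the pieces and refining them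
  gives the bound (\<open>Lip_mu_b_le\<close>).

  The local part does pass to minima, because \<open>\<mu>\<^sup>c(u)\<close> on a Borel set \<open>B\<close> depends only on the
  restriction of the continuous function \<open>u\<close> to \<open>B\<close> (\<open>mu_local\<close>).  This sharpening of the locality
  on open sets amounts to \<open>\<mu>\<^sup>c(u)(u = 0) = 0\<close>, which holds because \<open>u\<close> is a limit of the
  functions \<open>u - ((-\<delta>) \<or> (u \<and> \<delta>))\<close>, which vanish near \<open>{u = 0}\<close>.  The limit is controlled by a lower
  semicontinuity property (\<open>energy_lower_semicontinuous\<close>) that follows from completeness of the form
  domain and the parallelogram law.

  A bounded nonnegative \<open>f\<close> is the limit of the minima of finitely many functions
  \<open>f(y\<^sub>i) + \<rho>(\<cdot>, y\<^sub>i) \<and> T\<close> with \<open>y\<^sub>i\<close> running through a dense sequence.  To stay in the form domain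
  without a product rule, these functions are localized by taking the minimum with a multiple
  \<open>c \<eta>\<close> of a cutoff function instead of multiplying by \<open>\<eta>\<close>.  The measure
  \<open>m\<^sub>c\<close> restricted to \<open>supp \<eta>\<close> plus \<open>c\<^sup>2 \<mu>\<^sup>c(\<eta>)\<close> bounds the energy measures of all approximants, and it
  equals \<open>m\<^sub>c\<close> where \<open>\<eta> = 1\<close>.  Together with the jump bound it keeps the energies bounded, so lower
  semicontinuity applies (\<open>clamp_Lip\<close>).
\<close>


section \<open>Positive semidefinite forms\<close>

text \<open>
  The Hilbert space arguments are needed for three kinds of forms on function spaces: the \<open>L\<^sup>2\<close> inner
  product, the energy form with and without the \<open>L\<^sup>2\<close> part, and \<open>(u, v) \<mapsto> \<mu>\<^sup>c(u, v)(B)\<close> for a fixed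
  Borel set \<open>B\<close>.
\<close>
locale psd_form =
  fixes V :: "('a \<Rightarrow> real) set" and b :: "('a \<Rightarrow> real) \<Rightarrow> ('a \<Rightarrow> real) \<Rightarrow> real"
  assumes add_closed: "u \<in> V \<Longrightarrow> v \<in> V \<Longrightarrow> (\<lambda>x. u x + v x) \<in> V"
    and scale_closed: "u \<in> V \<Longrightarrow> (\<lambda>x. c * u x) \<in> V"
    and sym: "u \<in> V \<Longrightarrow> v \<in> V \<Longrightarrow> b u v = b v u"
    and add_left: "u \<in> V \<Longrightarrow> v \<in> V \<Longrightarrow> w \<in> V \<Longrightarrow> b (\<lambda>x. u x + v x) w = b u w + b v w"
    and scale_left: "u \<in> V \<Longrightarrow> w \<in> V \<Longrightarrow> b (\<lambda>x. c * u x) w = c * b u w"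
    and nonneg: "u \<in> V \<Longrightarrow> 0 \<le> b u u"
begin

lemma lincomb_closed: "u \<in> V \<Longrightarrow> v \<in> V \<Longrightarrow> (\<lambda>x. s * u x + t * v x) \<in> V"
  by (intro add_closed scale_closed)

lemma diff_closed: "u \<in> V \<Longrightarrow> v \<in> V \<Longrightarrow> (\<lambda>x. u x - v x) \<in> V"
  using lincomb_closed[of u v 1 "-1"] by simp

lemma lincomb_left:
  "u \<in> V \<Longrightarrow> v \<in> V \<Longrightarrow> w \<in> V \<Longrightarrow> b (\<lambda>x. s * u x + t * v x) w = s * b u w + t * b v w"
  by (simp add: add_left scale_left scale_closed)

lemma diff_left: "u \<in> V \<Longrightarrow> v \<in> V \<Longrightarrow> w \<in> V \<Longrightarrow> b (\<lambda>x. u x - v x) w = b u w - b v w"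
  using lincomb_left[of u v w 1 "-1"] by simp

lemma lincomb_diag:
  assumes "u \<in> V" "v \<in> V"
  shows "b (\<lambda>x. s * u x + t * v x) (\<lambda>x. s * u x + t * v x) =
    s\<^sup>2 * b u u + 2 * s * t * b u v + t\<^sup>2 * b v v"
proof -
  let ?w = "\<lambda>x. s * u x + t * v x"
  have w: "?w \<in> V" using assms by (rule lincomb_closed)
  have "b ?w ?w = s * b ?w u + t * b ?w v"
    using assms w by (simp add: lincomb_left sym[of u ?w] sym[of v ?w])
  also have "\<dots> = s * (s * b u u + t * b v u) + t * (s * b u v + t * b v v)"
    using assms by (simp add: lincomb_left)
  finally show ?thesis using assms sym[of v u] by (simp add: power2_eq_square algebra_simps)
qed

lemma scale_diag: "u \<in> V \<Longrightarrow> b (\<lambda>x. c * u x) (\<lambda>x. c * u x) = c\<^sup>2 * b u u"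
  using lincomb_diag[of u u c 0] by simp

lemma add_diag: "u \<in> V \<Longrightarrow> v \<in> V \<Longrightarrow>
    b (\<lambda>x. u x + v x) (\<lambda>x. u x + v x) = b u u + 2 * b u v + b v v"
  using lincomb_diag[of u v 1 1] by simp

lemma diff_diag: "u \<in> V \<Longrightarrow> v \<in> V \<Longrightarrow>
    b (\<lambda>x. u x - v x) (\<lambda>x. u x - v x) = b u u - 2 * b u v + b v v"
  using lincomb_diag[of u v 1 "-1"] by simp

lemma diff_commute: "u \<in> V \<Longrightarrow> v \<in> V \<Longrightarrow>
    b (\<lambda>x. u x - v x) (\<lambda>x. u x - v x) = b (\<lambda>x. v x - u x) (\<lambda>x. v x - u x)"
  by (simp add: diff_diag sym[of u v])

lemma parallelogram:
  assumes "u \<in> V" "v \<in> V"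
  shows "b (\<lambda>x. 1/2 * u x + 1/2 * v x) (\<lambda>x. 1/2 * u x + 1/2 * v x)
    = (b u u + b v v) / 2 - b (\<lambda>x. u x - v x) (\<lambda>x. u x - v x) / 4"
  unfolding lincomb_diag[OF assms] diff_diag[OF assms] by (simp add: power2_eq_square field_simps)

lemma midpoint_le:
  assumes "u \<in> V" "v \<in> V" "b u u \<le> c" "b v v \<le> c"
  shows "b (\<lambda>x. 1/2 * u x + 1/2 * v x) (\<lambda>x. 1/2 * u x + 1/2 * v x) \<le> c"
proof -
  define d where "d = b (\<lambda>x. u x - v x) (\<lambda>x. u x - v x)"
  have "0 \<le> d" unfolding d_def using assms by (intro nonneg diff_closed)
  then show ?thesis
    unfolding parallelogram[OF assms(1,2)] d_def[symmetric]
    using assms(3,4) by (simp add: field_simps)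
qed

lemma Cauchy_Schwarz:
  assumes "u \<in> V" "v \<in> V"
  shows "(b u v)\<^sup>2 \<le> b u u * b v v"
proof -
  have q: "0 \<le> s\<^sup>2 * b u u + 2 * s * t * b u v + t\<^sup>2 * b v v" for s t
    using nonneg[OF lincomb_closed[OF assms, of s t]] unfolding lincomb_diag[OF assms] .
  show ?thesis
  proof (cases "b v v = 0")
    case True
    have "b u v = 0"
    proof (rule ccontr)
      assume n: "b u v \<noteq> 0"
      have "2 * (- (b u u + 1) / (2 * b u v)) * b u v = - (b u u + 1)" using n by simp
      with q[of 1 "- (b u u + 1) / (2 * b u v)"] True show False by simp
    qed
    then show ?thesis using True by simp
  next
    case False
    with nonneg[OF assms(2)] have p: "b v v > 0" by simp
    have "b v v * (b u u * b v v - (b u v)\<^sup>2) \<ge> 0"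
      using q[of "b v v" "- b u v"] by (simp add: power2_eq_square algebra_simps)
    then show ?thesis using p by (simp add: zero_le_mult_iff)
  qed
qed

lemma null_left: "u \<in> V \<Longrightarrow> v \<in> V \<Longrightarrow> b u u = 0 \<Longrightarrow> b u v = 0"
  using Cauchy_Schwarz[of u v] by simp

lemma diag_eq_if_diff_null:
  assumes "u \<in> V" "v \<in> V" "b (\<lambda>x. u x - v x) (\<lambda>x. u x - v x) = 0"
  shows "b u u = b v v"
proof -
  note d = diff_closed[OF assms(1,2)]
  have "b u u - b v u = 0" "b u v - b v v = 0"
    using null_left[OF d _ assms(3)] diff_left[OF assms(1,2)] assms(1,2) by metis+
  then show ?thesis using sym[OF assms(1,2)] by simp
qed

lemma triangle:
  assumes "u \<in> V" "v \<in> V"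
  shows "sqrt (b (\<lambda>x. u x + v x) (\<lambda>x. u x + v x)) \<le> sqrt (b u u) + sqrt (b v v)"
proof -
  have "b u v \<le> sqrt (b u u * b v v)" using Cauchy_Schwarz[OF assms] by (rule real_le_rsqrt)
  then have "b (\<lambda>x. u x + v x) (\<lambda>x. u x + v x) \<le> (sqrt (b u u) + sqrt (b v v))\<^sup>2"
    unfolding add_diag[OF assms] using assms nonneg
    by (simp add: power2_sum real_sqrt_mult)
  then show ?thesis using assms nonneg by (intro real_le_lsqrt) auto
qed

text \<open>
  Convergence in the energy norm implies convergence in every weaker seminorm, such as the one of
  \<open>\<mu>\<^sup>c(\<cdot>, \<cdot>)(B)\<close>; this lemma then carries bounds over to the limit.
\<close>
lemma closed_ball_limit:
  assumes "v \<in> V" "\<And>n. w n \<in> V" "\<And>n. b (w n) (w n) \<le> c"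
    and "(\<lambda>n. b (\<lambda>x. w n x - v x) (\<lambda>x. w n x - v x)) \<longlonglongrightarrow> 0"
  shows "b v v \<le> c"
proof -
  have c: "0 \<le> c" using nonneg[OF assms(2)] assms(3) order_trans by blast
  have "sqrt (b v v) \<le> sqrt c + sqrt (b (\<lambda>x. w n x - v x) (\<lambda>x. w n x - v x))" for n
  proof -
    have "sqrt (b v v) \<le> sqrt (b (w n) (w n)) + sqrt (b (\<lambda>x. v x - w n x) (\<lambda>x. v x - w n x))"
      using triangle[OF assms(2) diff_closed[OF assms(1,2)], of n n] by simp
    also have "\<dots> \<le> sqrt c + sqrt (b (\<lambda>x. w n x - v x) (\<lambda>x. w n x - v x))"
      unfolding diff_commute[OF assms(1) assms(2)[of n]] using assms(3)[of n]
      by (intro add_right_mono real_sqrt_le_mono)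
    finally show ?thesis .
  qed
  moreover have "(\<lambda>n. sqrt c + sqrt (b (\<lambda>x. w n x - v x) (\<lambda>x. w n x - v x))) \<longlonglongrightarrow> sqrt c + sqrt 0"
    using assms(4) by (intro tendsto_intros)
  ultimately have "sqrt (b v v) \<le> sqrt c"
    by (intro LIMSEQ_le_const[where X="\<lambda>n. sqrt c + sqrt (b (\<lambda>x. w n x - v x) (\<lambda>x. w n x - v x))"]) auto
  then show ?thesis by simp
qed

text \<open>
  This is the part of Mazur's lemma that is needed later: instead of convex combinations of a
  bounded sequence it uses elements of almost minimal norm in a decreasing sequence of convex sets;
  by the parallelogram law they form a Cauchy sequence.
\<close>
lemma Cauchy_selection:
  assumes sub: "\<And>n. S n \<subseteq> V" and dec: "\<And>n. S (Suc n) \<subseteq> S n"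
    and mid: "\<And>n u v. u \<in> S n \<Longrightarrow> v \<in> S n \<Longrightarrow> (\<lambda>x. 1/2 * u x + 1/2 * v x) \<in> S n"
    and bound: "\<And>n. \<exists>u\<in>S n. b u u \<le> K"
  obtains w where "\<forall>n::nat. w n \<in> S n"
    "\<forall>e>0. \<exists>N. \<forall>i\<ge>N. \<forall>j\<ge>N. b (\<lambda>x. w i x - w j x) (\<lambda>x. w i x - w j x) < e"
proof -
  define d where "d n = (INF u\<in>S n. b u u)" for n
  have bdd: "bdd_below ((\<lambda>u. b u u) ` S n)" for n
    using sub nonneg by (intro bdd_belowI2[of _ 0]) blast
  have low: "d n \<le> b u u" if "u \<in> S n" for n u
    unfolding d_def using bdd that by (rule cINF_lower)
  have anti: "S j \<subseteq> S i" if "i \<le> j" for i j using dec that by (rule lift_Suc_antimono_le)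
  have ne: "S n \<noteq> {}" for n using bound by blast
  have dmono: "d i \<le> d j" if "i \<le> j" for i j
    unfolding d_def using anti[OF that] ne bdd by (intro cINF_superset_mono) auto
  have "d n \<le> K" for n using bound low order_trans by blast
  then have "Bseq d"
    using dmono by (intro BseqI'[of d "max \<bar>d 0\<bar> \<bar>K\<bar>"]) (smt (verit) real_norm_def le0)
  then have "convergent d" using dmono by (intro Bseq_mono_convergent) auto
  then have dC: "Cauchy d" by (rule convergent_Cauchy)
  have "\<exists>u\<in>S n. b u u < d n + 1 / Suc n" for n
    using cINF_less_iff[OF ne bdd, of n "d n + 1 / Suc n"] unfolding d_def by simp
  then obtain w where w: "\<And>n. w n \<in> S n" "\<And>n. b (w n) (w n) < d n + 1 / Suc n" by metis
  have wV: "w n \<in> V" for n using w sub by blast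
  have est: "b (\<lambda>x. w i x - w j x) (\<lambda>x. w i x - w j x) \<le> 2 * (d j - d i) + 4 / Suc i" if "i \<le> j" for i j
  proof -
    \<comment> \<open>The midpoint of \<open>w i\<close> and \<open>w j\<close> lies in \<open>S i\<close>, so its square norm is at least \<open>d i\<close>.\<close>
    define \<delta> where "\<delta> = b (\<lambda>x. w i x - w j x) (\<lambda>x. w i x - w j x)"
    have "d i \<le> b (\<lambda>x. 1/2 * w i x + 1/2 * w j x) (\<lambda>x. 1/2 * w i x + 1/2 * w j x)"
      using w anti[OF that] by (intro low mid) auto
    then have "d i \<le> (b (w i) (w i) + b (w j) (w j)) / 2 - \<delta> / 4"
      unfolding parallelogram[OF wV wV] \<delta>_def .
    moreover have "1 / Suc j \<le> 1 / Suc i" using that by (simp add: field_simps)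
    ultimately have "\<delta> \<le> 2 * (d j - d i) + 4 * (1 / Suc i)"
      using w(2)[of i] w(2)[of j] by argo
    then show ?thesis unfolding \<delta>_def by simp
  qed
  show ?thesis
  proof (rule that; intro allI impI)
    show "w n \<in> S n" for n by (rule w(1))
    fix e :: real assume e: "e > 0"
    obtain N1 where N1: "\<And>i j. i \<ge> N1 \<Longrightarrow> j \<ge> N1 \<Longrightarrow> dist (d i) (d j) < e / 4"
      using dC e unfolding Cauchy_def by (meson divide_pos_pos zero_less_numeral)
    obtain N2 :: nat where N2: "8 / e < N2" using reals_Archimedean2 by blast
    have small: "b (\<lambda>x. w i x - w j x) (\<lambda>x. w i x - w j x) < e" if "N1 \<le> i" "N2 \<le> i" "i \<le> j" for i j
    proof -
      have "8 / e < Suc i" using N2 that by simp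
      then have "4 / Suc i < e / 2" using e by (simp add: field_simps)
      moreover have "d j - d i < e / 4" using N1[of i j] that unfolding dist_real_def by linarith
      ultimately show ?thesis using est[OF that(3)] by simp
    qed
    show "\<exists>N. \<forall>i\<ge>N. \<forall>j\<ge>N. b (\<lambda>x. w i x - w j x) (\<lambda>x. w i x - w j x) < e"
      using small diff_commute[OF wV wV] by (intro exI[of _ "max N1 N2"]) (metis max.boundedE nle_le)
  qed
qed

end


section \<open>Relatively compact sets\<close>

lemma compact_closure_subset:
  fixes K :: "'a::t2_space set"
  assumes "compact K" "A \<subseteq> K"
  shows "compact (closure A)"
proof -
  have "closure A \<subseteq> K" using assms compact_imp_closed by (intro closure_minimal) auto
  then have "K \<inter> closure A = closure A" by blast
  then show ?thesis using compact_Int_closed[OF assms(1) closed_closure, of A] by simp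
qed

lemma relatively_compact_point_neighbourhood:
  fixes x :: "'a::metric_space"
  assumes "locally compact (UNIV :: 'a set)"
  shows "\<exists>G. open G \<and> compact (closure G) \<and> x \<in> G"
proof -
  have "openin (top_of_set UNIV) (UNIV :: 'a set)" by simp
  then obtain U V where U: "openin (top_of_set UNIV) U" "compact V" "x \<in> U" "U \<subseteq> V"
    using assms unfolding locally_def by (metis UNIV_I)
  have "compact (closure U)" using U(2,4) by (rule compact_closure_subset)
  then show ?thesis using U by (auto simp: open_openin[symmetric])
qed

lemma relatively_compact_neighbourhood:
  fixes K :: "'a::metric_space set"
  assumes "locally compact (UNIV :: 'a set)" "compact K"
  obtains G where "open G" "compact (closure G)" "K \<subseteq> G"
proof -
  define N where "N x = (SOME G. open G \<and> compact (closure G) \<and> x \<in> G)" for x :: 'a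
  have N: "open (N x) \<and> compact (closure (N x)) \<and> x \<in> N x" for x
    unfolding N_def by (rule someI_ex) (rule relatively_compact_point_neighbourhood[OF assms(1)])
  obtain F where F: "F \<subseteq> K" "finite F" "K \<subseteq> (\<Union>x\<in>F. N x)"
    by (rule compactE_image[OF assms(2), of K N]) (use N in blast)+
  show ?thesis
  proof (rule that[of "\<Union>x\<in>F. N x"])
    show "compact (closure (\<Union>x\<in>F. N x))"
    proof (rule compact_closure_subset)
      show "compact (\<Union>x\<in>F. closure (N x))" using F(2) N by (intro compact_UN) auto
      show "(\<Union>x\<in>F. N x) \<subseteq> (\<Union>x\<in>F. closure (N x))" using closure_subset by (rule UN_mono[OF subset_refl])
    qed
  qed (use N F in auto)
qed

lemma relatively_compact_exhaustion:
  assumes "locally compact (UNIV :: 'a::{metric_space, second_countable_topology} set)"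
  obtains G :: "nat \<Rightarrow> 'a::{metric_space, second_countable_topology} set"
    where "\<forall>n. open (G n)" "\<forall>n. compact (closure (G n))" "(\<Union>n. G n) = UNIV"
proof -
  let ?F = "{G :: 'a set. open G \<and> compact (closure G)}"
  obtain F where F: "F \<subseteq> ?F" "countable F" "\<Union>F = \<Union>?F" by (rule Lindelof[of ?F]) auto
  have "\<Union>?F = UNIV" using relatively_compact_point_neighbourhood[OF assms] by blast
  with F have c: "\<Union>F = UNIV" by simp
  then have "F \<noteq> {}" by auto
  then have r: "range (from_nat_into F) = F" using F(2) by (rule range_from_nat_into)
  have "from_nat_into F n \<in> ?F" for n using F(1) r by blast
  then show ?thesis using r c by (intro that[of "from_nat_into F"]) auto
qed

lemma bump_function:
  fixes K :: "'a::metric_space set"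
  assumes "locally compact (UNIV :: 'a set)" "compact K"
  obtains f where "f \<in> C_c" "\<And>x. x \<in> K \<Longrightarrow> f x = (1::real)"
proof (cases "K = {}")
  case True
  have "(\<lambda>x::'a. 0::real) \<in> C_c" unfolding C_c_def by simp
  with True show ?thesis using that by blast
next
  case False
  obtain G where G: "open G" "compact (closure G)" "K \<subseteq> G"
    using relatively_compact_neighbourhood[OF assms] .
  obtain e where e: "e > 0" "(\<Union>x\<in>K. cball x e) \<subseteq> G"
    using compact_subset_open_imp_cball_epsilon_subset[OF assms(2) G(1,3)] .
  define f where "f x = max 0 (1 - infdist x K / e)" for x
  have "x \<in> G" if "f x \<noteq> 0" for x
  proof -
    have "infdist x K < e" using that e unfolding f_def by (auto simp: max_def field_simps split: if_splits)
    then obtain y where "y \<in> K" "dist x y < e"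
      unfolding infdist_notempty[OF False] by (subst (asm) cINF_less_iff[OF False]) auto
    then show ?thesis using e(2) by (force simp: dist_commute)
  qed
  then have "{x. f x \<noteq> 0} \<subseteq> closure G" using closure_subset by blast
  with G(2) have "compact (closure {x. f x \<noteq> 0})" by (rule compact_closure_subset)
  moreover have "continuous_on UNIV f" unfolding f_def by (intro continuous_intros) (use e in auto)
  ultimately have "f \<in> C_c" unfolding C_c_def by simp
  moreover have "f x = 1" if "x \<in> K" for x using that unfolding f_def by simp
  ultimately show ?thesis using that by blast
qed


section \<open>Borel sets and set functions\<close>

lemma signed_measure_empty:
  assumes "signed_measure \<nu>" shows "\<nu> {} = 0"
proof -
  have "(\<lambda>n::nat. \<nu> {}) sums \<nu> (\<Union>n::nat. {})"
    using assms[unfolded signed_measure_def, rule_format, of "\<lambda>n. {}"]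
    by (simp add: disjoint_family_on_def)
  then show ?thesis using summable_LIMSEQ_zero sums_summable LIMSEQ_const_iff by blast
qed

lemma signed_measure_Un:
  assumes "signed_measure \<nu>" "A \<in> sets borel" "B \<in> sets borel" "A \<inter> B = {}"
  shows "\<nu> (A \<union> B) = \<nu> A + \<nu> B"
proof -
  let ?F = "binaryset A B"
  have "(\<lambda>n. \<nu> (?F n)) sums \<nu> (\<Union>n. ?F n)"
    using assms(2-4) by (intro assms(1)[unfolded signed_measure_def, rule_format])
      (auto simp: binaryset_def disjoint_family_on_def)
  moreover have "(\<lambda>n. \<nu> (?F n)) sums (\<nu> A + \<nu> B)"
    using signed_measure_empty[OF assms(1)] by (rule binaryset_sums)
  ultimately show ?thesis using sums_unique2 UN_binaryset_eq by metis
qed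

lemma supp_subset_closure: "supp m v \<subseteq> closure {x. v x \<noteq> 0}"
proof
  fix x assume x: "x \<in> supp m v"
  show "x \<in> closure {x. v x \<noteq> 0}"
  proof (rule ccontr)
    assume "x \<notin> closure {x. v x \<noteq> 0}"
    then have "x \<in> - closure {x. v x \<noteq> 0}" "open (- closure {x. v x \<noteq> 0})" by auto
    moreover have "AE y in m. y \<in> - closure {x. v x \<noteq> 0} \<longrightarrow> v y = 0"
      using closure_subset[of "{x. v x \<noteq> 0}"] by (intro AE_I2) auto
    ultimately show False using x unfolding supp_def by blast
  qed
qed

text \<open>
  Tonelli's theorem for counting measure.
\<close>
lemma ennreal_suminf_swap: "(\<Sum>i. \<Sum>n. f i n) = (\<Sum>n. \<Sum>i. f i n)"
  for f :: "nat \<Rightarrow> nat \<Rightarrow> ennreal"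
proof -
  have "(\<Sum>i. \<Sum>n. f i n) = (\<Sum>i. \<integral>\<^sup>+n. f i n \<partial>count_space UNIV)"
    by (simp add: nn_integral_count_space_nat)
  also have "\<dots> = (\<integral>\<^sup>+n. (\<Sum>i. f i n) \<partial>count_space UNIV)" by (rule nn_integral_suminf[symmetric]) simp
  finally show ?thesis by (simp add: nn_integral_count_space_nat)
qed

lemma emeasure_eq_suminf_partition:
  assumes "sets \<nu> = sets borel" "B \<in> sets borel"
    "\<forall>n. P n \<in> sets borel" "disjoint_family P" "(\<Union>n. P n) = UNIV"
  shows "emeasure \<nu> B = (\<Sum>n::nat. emeasure \<nu> (B \<inter> P n))"
proof -
  have "(\<Sum>n. emeasure \<nu> (B \<inter> P n)) = emeasure \<nu> (\<Union>n. B \<inter> P n)"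
  proof (rule suminf_emeasure)
    show "range (\<lambda>n. B \<inter> P n) \<subseteq> sets \<nu>" using assms by auto
    show "disjoint_family (\<lambda>n. B \<inter> P n)" using assms(4) by (auto simp: disjoint_family_on_def)
  qed
  also have "(\<Union>n. B \<inter> P n) = B" using assms(5) by auto
  finally show ?thesis by simp
qed

lemma closed_diag: "closed (diag :: ('a::metric_space \<times> 'a) set)"
proof -
  have "diag = {p :: 'a \<times> 'a. fst p = snd p}" by auto
  then show ?thesis by (simp add: closed_Collect_eq continuous_on_fst continuous_on_snd)
qed

lemma diag_borel [measurable]: "diag \<in> sets (borel :: ('a::metric_space \<times> 'a) measure)"
  by (rule borel_closed[OF closed_diag])

lemma swap_borel: "prod.swap \<in> (borel :: ('a::metric_space \<times> 'a) measure) \<rightarrow>\<^sub>M borel"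
  by (rule borel_measurable_continuous_onI) (simp add: prod.swap_def continuous_on_Pair continuous_on_fst continuous_on_snd)


section \<open>Regular Dirichlet forms and their strongly local part\<close>

locale beurling_deny_form =
  fixes m k :: "'a::{metric_space, second_countable_topology} measure"
    and D :: "('a \<Rightarrow> real) set"
    and E :: "('a \<Rightarrow> real) \<Rightarrow> ('a \<Rightarrow> real) \<Rightarrow> real"
    and J :: "('a \<times> 'a) measure"
    and \<mu>c :: "('a \<Rightarrow> real) \<Rightarrow> ('a \<Rightarrow> real) \<Rightarrow> 'a set \<Rightarrow> real"
  assumes locally_compact: "locally compact (UNIV :: 'a set)"
    and radon: "radon_measure m"
    and regular: "regular_dirichlet_form m D E"
    and decomposition: "beurling_deny m D E J k \<mu>c"
begin

lemma sets_m [measurable_cong]: "sets m = sets borel"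
  using radon by (simp add: radon_measure_def)

lemma space_m [simp]: "space m = UNIV"
  using sets_eq_imp_space_eq[OF sets_m] by simp

lemma borel_measurable_m [simp]: "borel_measurable m = borel_measurable borel"
  by (rule measurable_cong_sets) (auto simp: sets_m)

lemma dirichlet: "dirichlet_form m D E"
  using regular by (simp add: regular_dirichlet_form_def)

lemma symm: "symmetric_form m D E"
  using dirichlet by (simp add: dirichlet_form_def)

lemma D_L2: "u \<in> D \<Longrightarrow> u \<in> L2 m"
  using symm by (auto simp: symmetric_form_def)

lemma D_measurable: "u \<in> D \<Longrightarrow> u \<in> borel_measurable borel"
  using D_L2 by (auto simp: L2_def)

lemma D_zero: "(\<lambda>x. 0) \<in> D"
  using symm by (auto simp: symmetric_form_def)

lemma D_cong: "u \<in> D \<Longrightarrow> v \<in> borel_measurable borel \<Longrightarrow> (AE x in m. u x = v x) \<Longrightarrow> v \<in> D"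
  using symm unfolding symmetric_form_def by simp

lemma D_contraction:
  assumes "normal_contraction T" "u \<in> D"
  shows "(\<lambda>x. T (u x)) \<in> D" "E (\<lambda>x. T (u x)) (\<lambda>x. T (u x)) \<le> E u u"
proof -
  have "\<forall>T. normal_contraction T \<longrightarrow> (\<forall>u\<in>D. T \<circ> u \<in> D \<and> E (T \<circ> u) (T \<circ> u) \<le> E u u)"
    using dirichlet unfolding dirichlet_form_def by (elim conjE)
  from bspec[OF mp[OF spec[OF this] assms(1)] assms(2)]
  show "(\<lambda>x. T (u x)) \<in> D" "E (\<lambda>x. T (u x)) (\<lambda>x. T (u x)) \<le> E u u"
    by (simp_all add: comp_def)
qed

sublocale form: psd_form D E
proof
  note S = symm[unfolded symmetric_form_def]
  have add: "\<forall>u\<in>D. \<forall>v\<in>D. (\<lambda>x. u x + v x) \<in> D"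
    and scale: "\<forall>c. \<forall>u\<in>D. (\<lambda>x. c * u x) \<in> D"
    and sym: "\<forall>u\<in>D. \<forall>v\<in>D. E u v = E v u"
    and add_left: "\<forall>u\<in>D. \<forall>v\<in>D. \<forall>w\<in>D. E (\<lambda>x. u x + v x) w = E u w + E v w"
    and scale_left: "\<forall>c. \<forall>u\<in>D. \<forall>w\<in>D. E (\<lambda>x. c * u x) w = c * E u w"
    and nonneg: "\<forall>u\<in>D. 0 \<le> E u u"
    using S dirichlet unfolding dirichlet_form_def by - (elim conjE, assumption)+
  show "(\<lambda>x. u x + v x) \<in> D" if "u \<in> D" "v \<in> D" for u v by (rule add[rule_format, OF that])
  show "(\<lambda>x. c * u x) \<in> D" if "u \<in> D" for u c by (rule scale[rule_format, OF that])
  show "E u v = E v u" if "u \<in> D" "v \<in> D" for u v by (rule sym[rule_format, OF that])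
  show "E (\<lambda>x. u x + v x) w = E u w + E v w" if "u \<in> D" "v \<in> D" "w \<in> D" for u v w
    by (rule add_left[rule_format, OF that])
  show "E (\<lambda>x. c * u x) w = c * E u w" if "u \<in> D" "w \<in> D" for u w c
    by (rule scale_left[rule_format, OF that])
  show "0 \<le> E u u" if "u \<in> D" for u by (rule nonneg[rule_format, OF that])
qed

lemma L2_integrable_product:
  assumes "u \<in> L2 m" "v \<in> L2 m"
  shows "integrable m (\<lambda>x. u x * v x)"
proof (rule Bochner_Integration.integrable_bound)
  show "integrable m (\<lambda>x. (u x)\<^sup>2 + (v x)\<^sup>2)" using assms by (auto simp: L2_def)
  show "(\<lambda>x. u x * v x) \<in> borel_measurable m" using assms by (auto simp: L2_def)
  have "\<bar>a * b\<bar> \<le> a\<^sup>2 + b\<^sup>2" for a b :: real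
    using zero_le_power2[of "\<bar>a\<bar> - \<bar>b\<bar>"] mult_nonneg_nonneg[of "\<bar>a\<bar>" "\<bar>b\<bar>"]
    unfolding power2_diff abs_mult power2_abs by linarith
  then show "AE x in m. norm (u x * v x) \<le> norm ((u x)\<^sup>2 + (v x)\<^sup>2)" by simp
qed

sublocale L2: psd_form "L2 m" "\<lambda>u v. \<integral>x. u x * v x \<partial>m"
proof
  fix u v assume uv: "u \<in> L2 m" "v \<in> L2 m"
  have "integrable m (\<lambda>x. (u x)\<^sup>2 + (v x)\<^sup>2 + 2 * (u x * v x))"
    using uv L2_integrable_product[OF uv] by (auto simp: L2_def)
  then have "integrable m (\<lambda>x. (u x + v x)\<^sup>2)" by (simp add: power2_sum algebra_simps)
  then show "(\<lambda>x. u x + v x) \<in> L2 m" using uv by (auto simp: L2_def)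
  fix w assume w: "w \<in> L2 m"
  show "(\<integral>x. (u x + v x) * w x \<partial>m) = (\<integral>x. u x * w x \<partial>m) + (\<integral>x. v x * w x \<partial>m)"
    using L2_integrable_product[OF uv(1) w] L2_integrable_product[OF uv(2) w]
    by (simp add: distrib_right)
next
  fix u c assume "u \<in> L2 m"
  then show "(\<lambda>x. c * u x) \<in> L2 m" by (auto simp: L2_def power_mult_distrib)
next
  fix u w :: "'a \<Rightarrow> real" and c :: real
  show "(\<integral>x. (c * u x) * w x \<partial>m) = c * (\<integral>x. u x * w x \<partial>m)" by (simp add: mult.assoc)
qed (simp_all add: mult.commute)

sublocale E1: psd_form D "\<lambda>u v. E u v + (\<integral>x. u x * v x \<partial>m)"
proof
  fix u v assume "u \<in> D" "v \<in> D"
  then show "E u v + (\<integral>x. u x * v x \<partial>m) = E v u + (\<integral>x. v x * u x \<partial>m)"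
    by (simp add: form.sym mult.commute)
next
  fix u v w assume "u \<in> D" "v \<in> D" "w \<in> D"
  then show "E (\<lambda>x. u x + v x) w + (\<integral>x. (u x + v x) * w x \<partial>m) =
      (E u w + (\<integral>x. u x * w x \<partial>m)) + (E v w + (\<integral>x. v x * w x \<partial>m))"
    using L2.add_left[OF D_L2 D_L2 D_L2, of u v w] form.add_left[of u v w] by simp
next
  fix u w c assume "u \<in> D" "w \<in> D"
  then show "E (\<lambda>x. c * u x) w + (\<integral>x. (c * u x) * w x \<partial>m) = c * (E u w + (\<integral>x. u x * w x \<partial>m))"
    using L2.scale_left[OF D_L2 D_L2, of u w c] form.scale_left[of u w c]
    by (simp only: distrib_left)
next
  fix u assume "u \<in> D"
  then show "0 \<le> E u u + (\<integral>x. u x * u x \<partial>m)" by (simp add: form.nonneg)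
qed (rule form.add_closed form.scale_closed, assumption+)+

lemma E1_eq: "E1 m E u = E u u + (\<integral>x. u x * u x \<partial>m)"
  by (simp add: E1_def power2_eq_square)

lemma complete:
  assumes "\<forall>n::nat. w n \<in> D"
    and "\<forall>e>0. \<exists>N. \<forall>i\<ge>N. \<forall>j\<ge>N. E1 m E (\<lambda>x. w i x - w j x) < e"
  obtains v where "v \<in> D" "(\<lambda>n. E1 m E (\<lambda>x. w n x - v x)) \<longlonglongrightarrow> 0"
proof -
  have "\<forall>u. (\<forall>n::nat. u n \<in> D) \<longrightarrow>
          (\<forall>e>0. \<exists>N. \<forall>i\<ge>N. \<forall>j\<ge>N. E1 m E (\<lambda>x. u i x - u j x) < e) \<longrightarrow>
          (\<exists>v\<in>D. (\<lambda>n. E1 m E (\<lambda>x. u n x - v x)) \<longlonglongrightarrow> 0)"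
    using dirichlet unfolding dirichlet_form_def by (elim conjE)
  from mp[OF mp[OF spec[OF this, of w] assms(1)] assms(2)]
  have "\<exists>v\<in>D. (\<lambda>n. E1 m E (\<lambda>x. w n x - v x)) \<longlonglongrightarrow> 0" .
  then show thesis using that by (elim bexE)
qed

lemma D_abs:
  assumes "u \<in> D"
  shows "(\<lambda>x. \<bar>u x\<bar>) \<in> D"
proof -
  have "normal_contraction abs" by (auto simp: normal_contraction_def)
  from D_contraction(1)[OF this assms] show ?thesis .
qed

lemma D_min:
  assumes "u \<in> D" "v \<in> D"
  shows "(\<lambda>x. min (u x) (v x)) \<in> D"
proof -
  have "(\<lambda>x. \<bar>u x - v x\<bar>) \<in> D" by (rule D_abs[OF form.diff_closed[OF assms]])
  then have "(\<lambda>x. 1/2 * (u x + v x) + (-1/2) * \<bar>u x - v x\<bar>) \<in> D"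
    by (intro form.lincomb_closed form.add_closed assms)
  moreover have "(\<lambda>x. 1/2 * (u x + v x) + (-1/2) * \<bar>u x - v x\<bar>) = (\<lambda>x. min (u x) (v x))"
  proof
    fix x show "1/2 * (u x + v x) + (-1/2) * \<bar>u x - v x\<bar> = min (u x) (v x)"
      by (cases "u x \<le> v x") (simp_all add: field_simps)
  qed
  ultimately show ?thesis by simp
qed

text \<open>
  Regularity provides an element of \<open>D\<close> with compact support uniformly close to a bump function; its
  values are at least \<open>1/2\<close> on \<open>K\<close>, and doubling and clipping to \<open>[0, 1]\<close> makes it constant there.
\<close>
lemma cutoff:
  assumes "compact K"
  obtains \<eta> where "\<eta> \<in> D" "\<eta> \<in> C_c" "\<forall>x. 0 \<le> \<eta> x \<and> \<eta> x \<le> 1" "\<forall>x\<in>K. \<eta> x = 1"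
proof -
  obtain f where f: "f \<in> C_c" "\<And>x. x \<in> K \<Longrightarrow> f x = (1::real)"
    using bump_function[OF locally_compact assms] by blast
  have "\<forall>f\<in>C_c. \<forall>e>0. \<exists>v\<in>D \<inter> C_c. \<forall>x. \<bar>f x - v x\<bar> < e"
    using regular unfolding regular_dirichlet_form_def by (elim conjE)
  from this[rule_format, OF f(1), of "1/2"]
  have "\<exists>v\<in>D \<inter> C_c. \<forall>x. \<bar>f x - v x\<bar> < 1/2" by simp
  then obtain v where v: "v \<in> D" "v \<in> C_c" "\<And>x. \<bar>f x - v x\<bar> < 1/2"
    by blast
  define \<eta> where "\<eta> x = max 0 (min (2 * v x) 1)" for x
  have T: "normal_contraction (\<lambda>t. max 0 (min t 1))"
    unfolding normal_contraction_def by (intro conjI allI) linarith+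
  have D: "\<eta> \<in> D"
    using D_contraction(1)[OF T form.scale_closed[OF v(1), of 2]] unfolding \<eta>_def .
  have c: "continuous_on UNIV \<eta>"
    unfolding \<eta>_def using v(2) by (intro continuous_intros) (simp add: C_c_def)
  have "{x. \<eta> x \<noteq> 0} \<subseteq> {x. v x \<noteq> 0}" by (intro Collect_mono impI notI) (simp add: \<eta>_def)
  then have "{x. \<eta> x \<noteq> 0} \<subseteq> closure {x. v x \<noteq> 0}" using closure_subset by (rule subset_trans)
  moreover have "compact (closure {x. v x \<noteq> 0})" using v(2) by (simp add: C_c_def)
  ultimately have "compact (closure {x. \<eta> x \<noteq> 0})" by (metis compact_closure_subset)
  then have C: "\<eta> \<in> C_c" using c by (simp add: C_c_def)
  have bounds: "\<forall>x. 0 \<le> \<eta> x \<and> \<eta> x \<le> 1" by (simp add: \<eta>_def)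
  have "\<eta> x = 1" if "x \<in> K" for x
    using f(2)[OF that] v(3)[of x] unfolding \<eta>_def by linarith
  then have "\<forall>x\<in>K. \<eta> x = 1" by (rule ballI)
  then show ?thesis by (rule that[OF D C bounds])
qed

subsection \<open>The energy measures\<close>

lemma strongly_local: "strongly_local_energy_form m D \<mu>c"
  using decomposition by (simp add: beurling_deny_def)

lemma mu_psd_form:
  "B \<in> sets borel \<Longrightarrow> psd_form D (\<lambda>u v. \<mu>c u v B)"
proof -
  assume B: "B \<in> sets borel"
  have sym: "\<forall>u\<in>D. \<forall>v\<in>D. \<forall>B\<in>sets borel. \<mu>c u v B = \<mu>c v u B"
    and add_left: "\<forall>u\<in>D. \<forall>v\<in>D. \<forall>w\<in>D. \<forall>B\<in>sets borel.
      \<mu>c (\<lambda>x. u x + v x) w B = \<mu>c u w B + \<mu>c v w B"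
    and scale_left: "\<forall>c. \<forall>u\<in>D. \<forall>w\<in>D. \<forall>B\<in>sets borel. \<mu>c (\<lambda>x. c * u x) w B = c * \<mu>c u w B"
    and nonneg: "\<forall>u\<in>D. \<forall>B\<in>sets borel. 0 \<le> \<mu>c u u B"
    using strongly_local unfolding strongly_local_energy_form_def by - (elim conjE, assumption)+
  show ?thesis
  proof
    show "(\<lambda>x. u x + v x) \<in> D" if "u \<in> D" "v \<in> D" for u v by (rule form.add_closed[OF that])
    show "(\<lambda>x. c * u x) \<in> D" if "u \<in> D" for u c by (rule form.scale_closed[OF that])
    show "\<mu>c u v B = \<mu>c v u B" if "u \<in> D" "v \<in> D" for u v by (rule sym[rule_format, OF that B])
    show "\<mu>c (\<lambda>x. u x + v x) w B = \<mu>c u w B + \<mu>c v w B" if "u \<in> D" "v \<in> D" "w \<in> D" for u v w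
      by (rule add_left[rule_format, OF that B])
    show "\<mu>c (\<lambda>x. c * u x) w B = c * \<mu>c u w B" if "u \<in> D" "w \<in> D" for u w c
      by (rule scale_left[rule_format, OF that B])
    show "0 \<le> \<mu>c u u B" if "u \<in> D" for u by (rule nonneg[rule_format, OF that B])
  qed
qed

lemma mu_nonneg: "u \<in> D \<Longrightarrow> B \<in> sets borel \<Longrightarrow> 0 \<le> \<mu>c u u B"
  by (rule psd_form.nonneg[OF mu_psd_form])

lemma mu_signed: "u \<in> D \<Longrightarrow> signed_measure (\<mu>c u u)"
  using strongly_local unfolding strongly_local_energy_form_def by (elim conjE) simp

lemma mu_split:
  assumes "u \<in> D" "B \<in> sets borel" "C \<in> sets borel"
  shows "\<mu>c u u B = \<mu>c u u (B \<inter> C) + \<mu>c u u (B - C)"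
  using signed_measure_Un[OF mu_signed[OF assms(1)], of "B \<inter> C" "B - C"] assms(2,3)
  by (simp add: Int_Diff_Un Int_Diff_disjoint)

lemma mu_mono:
  assumes "u \<in> D" "B \<in> sets borel" "C \<in> sets borel" "B \<subseteq> C"
  shows "\<mu>c u u B \<le> \<mu>c u u C"
proof -
  have "C \<inter> B = B" using assms(4) by blast
  with mu_split[OF assms(1,3,2)] mu_nonneg[OF assms(1), of "C - B"] assms(2,3)
  show ?thesis by simp
qed

lemma mu_open_local:
  assumes "u \<in> D" "v \<in> D" "open G" "AE x in m. x \<in> G \<longrightarrow> u x = v x" "B \<in> sets borel" "B \<subseteq> G"
  shows "\<mu>c u u B = \<mu>c v v B"
proof -
  have "\<forall>u\<in>D. \<forall>v\<in>D. \<forall>G. open G \<longrightarrow> (AE x in m. x \<in> G \<longrightarrow> u x = v x) \<longrightarrow>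
        (\<forall>B\<in>sets borel. B \<subseteq> G \<longrightarrow> \<mu>c u u B = \<mu>c v v B)"
    using strongly_local unfolding strongly_local_energy_form_def by (elim conjE)
  from this[rule_format, OF assms] show ?thesis .
qed

lemma beurling_deny_formula:
  assumes "u \<in> D"
  shows "ennreal (E u u) =
      (\<integral>\<^sup>+(x, y)\<in>- diag. ennreal ((qc_rep m D E u x - qc_rep m D E u y)\<^sup>2) \<partial>J)
      + ennreal (\<mu>c u u UNIV)
      + (\<integral>\<^sup>+x. ennreal ((qc_rep m D E u x)\<^sup>2) \<partial>k)"
proof -
  have "\<forall>u\<in>D. ennreal (E u u) =
        (\<integral>\<^sup>+(x, y)\<in>- diag. ennreal ((qc_rep m D E u x - qc_rep m D E u y)\<^sup>2) \<partial>J)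
        + ennreal (\<mu>c u u UNIV)
        + (\<integral>\<^sup>+x. ennreal ((qc_rep m D E u x)\<^sup>2) \<partial>k)"
    using decomposition unfolding beurling_deny_def by (elim conjE)
  from bspec[OF this assms] show ?thesis .
qed

lemma mu_le_E:
  assumes "u \<in> D" "B \<in> sets borel"
  shows "\<mu>c u u B \<le> E u u"
proof -
  have "ennreal (\<mu>c u u UNIV) \<le> ennreal (E u u)"
    unfolding beurling_deny_formula[OF assms(1)] by (simp add: add_increasing add_increasing2)
  then have "\<mu>c u u UNIV \<le> E u u" using form.nonneg[OF assms(1)] by simp
  then show ?thesis using mu_mono[OF assms(1,2), of UNIV] by simp
qed

text \<open>
  Bounded sequences of the Hilbert space \<open>(D, E1)\<close> that converge in \<open>L\<^sup>2\<close> have their limit in \<open>D\<close>, and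
  energy measures are lower semicontinuous along them.  The limit is reached in the norm of \<open>E1\<close> by
  almost minimal elements of the convex sets of those \<open>v\<close> that satisfy the energy bound and are
  \<open>L\<^sup>2\<close>-close to \<open>f\<close>.
\<close>
lemma energy_lower_semicontinuous:
  assumes u: "\<And>n::nat. u n \<in> D" and K: "\<And>n. E1 m E (u n) \<le> K"
    and f: "f \<in> L2 m" and lim: "(\<lambda>n. \<integral>x. (u n x - f x)\<^sup>2 \<partial>m) \<longlonglongrightarrow> 0"
    and B: "B \<in> sets borel" and c: "\<And>n. \<mu>c (u n) (u n) B \<le> c"
  shows "f \<in> D" "\<mu>c f f B \<le> c"
proof -
  interpret mu: psd_form D "\<lambda>u v. \<mu>c u v B" using B by (rule mu_psd_form)
  define nrm where "nrm v = (\<integral>x. (v x - f x) * (v x - f x) \<partial>m)" for v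
  define S where "S n = {v \<in> D. \<mu>c v v B \<le> c \<and> nrm v \<le> 1 / Suc n}" for n
  have L: "(\<lambda>x. v x - f x) \<in> L2 m" if "v \<in> D" for v using L2.diff_closed[OF D_L2[OF that] f] .
  have sub: "S n \<subseteq> D" for n by (auto simp: S_def)
  have dec: "S (Suc n) \<subseteq> S n" for n
  proof -
    have "1 / real (Suc (Suc n)) \<le> 1 / real (Suc n)" by (simp add: field_simps)
    then show ?thesis unfolding S_def by force
  qed
  have mid: "(\<lambda>x. 1/2 * v x + 1/2 * v' x) \<in> S n" if v: "v \<in> S n" "v' \<in> S n" for n v v'
  proof -
    have "nrm (\<lambda>x. 1/2 * v x + 1/2 * v' x) =
      (\<integral>x. (1/2 * (v x - f x) + 1/2 * (v' x - f x)) * (1/2 * (v x - f x) + 1/2 * (v' x - f x)) \<partial>m)"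
      unfolding nrm_def by (rule Bochner_Integration.integral_cong) (auto simp: field_simps)
    also have "\<dots> \<le> 1 / Suc n"
      using v by (intro L2.midpoint_le L) (auto simp: S_def nrm_def)
    finally show ?thesis
      using v mu.midpoint_le[of v v' c] form.lincomb_closed[of v v' "1/2" "1/2"] by (auto simp: S_def)
  qed
  have bound: "\<exists>v\<in>S n. E v v + (\<integral>x. v x * v x \<partial>m) \<le> K" for n
  proof -
    have "\<forall>\<^sub>F i in sequentially. (\<integral>x. (u i x - f x)\<^sup>2 \<partial>m) < 1 / Suc n"
      using lim by (rule order_tendstoD) simp
    then obtain i where "(\<integral>x. (u i x - f x)\<^sup>2 \<partial>m) < 1 / Suc n"
      by (auto simp: eventually_sequentially)
    then have "u i \<in> S n" using u c by (simp add: S_def nrm_def power2_eq_square)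
    then show ?thesis using K[of i] by (auto simp: E1_eq)
  qed
  obtain w where w: "\<forall>n. w n \<in> S n"
    "\<forall>e>0. \<exists>N. \<forall>i\<ge>N. \<forall>j\<ge>N. E (\<lambda>x. w i x - w j x) (\<lambda>x. w i x - w j x)
        + (\<integral>x. (w i x - w j x) * (w i x - w j x) \<partial>m) < e"
    by (rule E1.Cauchy_selection[of S K, OF sub dec mid bound])
  have wD: "w n \<in> D" for n using w(1) by (auto simp: S_def)
  obtain v where v: "v \<in> D" "(\<lambda>n. E1 m E (\<lambda>x. w n x - v x)) \<longlonglongrightarrow> 0"
    by (rule complete[of w]) (use wD w(2) in \<open>simp_all add: E1_eq\<close>)
  have dom: "E (\<lambda>x. w n x - v x) (\<lambda>x. w n x - v x) \<le> E1 m E (\<lambda>x. w n x - v x)"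
    "(\<integral>x. (w n x - v x) * (w n x - v x) \<partial>m) \<le> E1 m E (\<lambda>x. w n x - v x)" for n
    using form.nonneg[OF form.diff_closed[OF wD v(1)]]
      L2.nonneg[OF L2.diff_closed[OF D_L2[OF wD] D_L2[OF v(1)]]]
    unfolding E1_eq by auto
  have "(\<lambda>n. \<integral>x. (w n x - v x) * (w n x - v x) \<partial>m) \<longlonglongrightarrow> 0"
    using dom(2) L2.nonneg[OF L2.diff_closed[OF D_L2[OF wD] D_L2[OF v(1)]]]
    by (intro tendsto_sandwich[OF _ _ tendsto_const v(2)]) auto
  then have conv: "(\<lambda>n. \<integral>x. (w (n + N) x - v x) * (w (n + N) x - v x) \<partial>m) \<longlonglongrightarrow> 0" for N
    by (rule LIMSEQ_ignore_initial_segment)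
  have "nrm v \<le> 1 / Suc N" for N
    unfolding nrm_def
  proof (rule L2.closed_ball_limit[OF L[OF v(1)] L[OF wD]])
    show "(\<integral>x. (w (n + N) x - f x) * (w (n + N) x - f x) \<partial>m) \<le> 1 / Suc N" for n
    proof -
      have "1 / real (Suc (n + N)) \<le> 1 / real (Suc N)" by (simp add: field_simps)
      then show ?thesis using w(1)[rule_format, of "n + N"] by (auto simp: S_def nrm_def)
    qed
  qed (use conv[of N] in simp)
  moreover have "(\<lambda>N. 1 / real (Suc N)) \<longlonglongrightarrow> 0" by (rule LIMSEQ_Suc[OF lim_1_over_n])
  ultimately have "nrm v \<le> 0" by (intro LIMSEQ_le_const) auto
  then have "nrm v = 0" using L2.nonneg[OF L[OF v(1)]] by (simp add: nrm_def)
  then have "AE x in m. (v x - f x) * (v x - f x) = 0"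
    unfolding nrm_def using L2_integrable_product[OF L[OF v(1)] L[OF v(1)]]
    by (subst (asm) integral_nonneg_eq_0_iff_AE) auto
  then have ae: "AE x in m. v x = f x" by simp
  show fD: "f \<in> D" using f by (intro D_cong[OF v(1) _ ae]) (auto simp: L2_def)
  have "(\<lambda>n. \<mu>c (\<lambda>x. w n x - v x) (\<lambda>x. w n x - v x) B) \<longlonglongrightarrow> 0"
    using order_trans[OF mu_le_E[OF form.diff_closed[OF wD v(1)] B] dom(1)]
      mu.nonneg[OF form.diff_closed[OF wD v(1)]]
    by (intro tendsto_sandwich[OF _ _ tendsto_const v(2)]) auto
  moreover have "\<mu>c (w n) (w n) B \<le> c" for n using w(1) by (simp add: S_def)
  ultimately have "\<mu>c v v B \<le> c" by (intro mu.closed_ball_limit[OF v(1) wD])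
  moreover have "\<mu>c v v B = \<mu>c f f B"
    using ae B by (intro mu_open_local[OF v(1) fD open_UNIV]) auto
  ultimately show "\<mu>c f f B \<le> c" by simp
qed

text \<open>
  With \<open>T\<^sub>n(t) = t - ((-\<delta>\<^sub>n) \<or> (t \<and> \<delta>\<^sub>n))\<close> and \<open>\<delta>\<^sub>n \<rightarrow> 0\<close>, the function \<open>T\<^sub>n \<circ> u\<close> vanishes on the open
  neighbourhood \<open>{\<bar>u\<bar> < \<delta>\<^sub>n}\<close> of \<open>B\<close>, so its energy measure does not charge \<open>B\<close>.  As \<open>T\<^sub>n\<close> is a normal
  contraction, the energies stay bounded and lower semicontinuity gives the claim.
\<close>
lemma mu_null:
  assumes u: "u \<in> D" "continuous_on UNIV u" and B: "B \<in> sets borel" "\<And>x. x \<in> B \<Longrightarrow> u x = 0"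
  shows "\<mu>c u u B = 0"
proof -
  define \<delta> where "\<delta> n = 1 / real (Suc n)" for n
  have \<delta>: "\<delta> n > 0" for n by (simp add: \<delta>_def)
  define T where "T n t = t - max (- \<delta> n) (min t (\<delta> n))" for n t
  define v where "v n x = T n (u x)" for n x
  have T: "normal_contraction (T n)" for n
    using \<delta>[of n] by (auto simp: normal_contraction_def T_def)
  have vD: "v n \<in> D" and vE: "E (v n) (v n) \<le> E u u" for n
    unfolding v_def using D_contraction[OF T u(1)] by auto
  have uL: "integrable m (\<lambda>x. (u x)\<^sup>2)" "u \<in> borel_measurable borel"
    using D_L2[OF u(1)] by (auto simp: L2_def)
  have Tle: "(T n t)\<^sup>2 \<le> t\<^sup>2" for n t
  proof -
    have "T n 0 = 0" using T[of n] by (simp add: normal_contraction_def)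
    moreover have "\<bar>T n t - T n 0\<bar> \<le> \<bar>t - 0\<bar>"
      using T[of n] unfolding normal_contraction_def by blast
    ultimately show ?thesis by (simp add: abs_le_square_iff)
  qed
  have close: "(T n t - t)\<^sup>2 \<le> (\<delta> n)\<^sup>2" "(T n t - t)\<^sup>2 \<le> t\<^sup>2" for n t
  proof -
    have "\<bar>T n t - t\<bar> \<le> \<bar>\<delta> n\<bar>" "\<bar>T n t - t\<bar> \<le> \<bar>t\<bar>"
      unfolding T_def using \<delta>[of n] by (simp_all add: max_def min_def abs_if)
    then show "(T n t - t)\<^sup>2 \<le> (\<delta> n)\<^sup>2" "(T n t - t)\<^sup>2 \<le> t\<^sup>2"
      by (simp_all only: abs_le_square_iff)
  qed
  have "\<mu>c u u B \<le> 0"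
  proof (rule energy_lower_semicontinuous(2)[of v "E1 m E u", OF vD _ D_L2[OF u(1)] _ B(1)])
    show "E1 m E (v n) \<le> E1 m E u" for n
    proof -
      have "(\<integral>x. (v n x)\<^sup>2 \<partial>m) \<le> (\<integral>x. (u x)\<^sup>2 \<partial>m)"
        using D_L2[OF vD] uL(1) Tle by (intro integral_mono) (auto simp: L2_def v_def)
      then show ?thesis using vE unfolding E1_def by (rule add_mono[rotated])
    qed
    have "(\<lambda>n. \<integral>x. (v n x - u x)\<^sup>2 \<partial>m) \<longlonglongrightarrow> (\<integral>x. 0 \<partial>m)"
    proof (rule integral_dominated_convergence[where w="\<lambda>x. (u x)\<^sup>2"])
      show "AE x in m. (\<lambda>n. (v n x - u x)\<^sup>2) \<longlonglongrightarrow> 0"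
      proof (rule AE_I2)
        fix x
        have "(\<lambda>n. \<delta> n) \<longlonglongrightarrow> 0" unfolding \<delta>_def by (rule LIMSEQ_Suc[OF lim_1_over_n])
        from tendsto_power[OF this, of 2] have lim: "(\<lambda>n. (\<delta> n)\<^sup>2) \<longlonglongrightarrow> 0" by simp
        have "norm ((v n x - u x)\<^sup>2) \<le> (\<delta> n)\<^sup>2" for n
          using close(1)[of n "u x"] by (simp add: v_def)
        then show "(\<lambda>n. (v n x - u x)\<^sup>2) \<longlonglongrightarrow> 0"
          by (intro Lim_null_comparison[OF always_eventually lim]) simp
      qed
      show "AE x in m. norm ((v n x - u x)\<^sup>2) \<le> (u x)\<^sup>2" for n
        using close(2) by (simp add: v_def)
    qed (use uL D_measurable[OF vD] in auto)
    then show "(\<lambda>n. \<integral>x. (v n x - u x)\<^sup>2 \<partial>m) \<longlonglongrightarrow> 0" by simp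
    fix n
    have "open {x. \<bar>u x\<bar> < \<delta> n}"
      using u(2) by (intro open_Collect_less continuous_intros)
    moreover have "B \<subseteq> {x. \<bar>u x\<bar> < \<delta> n}" using B(2) \<delta> by auto
    ultimately have "\<mu>c (v n) (v n) B = \<mu>c (\<lambda>x. 0) (\<lambda>x. 0) B"
      using B(1) by (intro mu_open_local[OF vD D_zero]) (auto simp: v_def T_def)
    also have "\<dots> = 0"
      using psd_form.scale_left[OF mu_psd_form[OF B(1)] D_zero D_zero, of 0] by simp
    finally show "\<mu>c (v n) (v n) B \<le> 0" by simp
  qed
  then show ?thesis using mu_nonneg[OF u(1) B(1)] by simp
qed

text \<open>
  Locality for sets that are not open, such as \<open>{u = v}\<close> itself; this is what makes energy measures
  of minima computable.
\<close>
lemma mu_local: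
  assumes "u \<in> D" "v \<in> D" "continuous_on UNIV u" "continuous_on UNIV v"
    and "B \<in> sets borel" "\<And>x. x \<in> B \<Longrightarrow> u x = v x"
  shows "\<mu>c u u B = \<mu>c v v B"
proof -
  have "\<mu>c (\<lambda>x. u x - v x) (\<lambda>x. u x - v x) B = 0"
    using assms by (intro mu_null form.diff_closed continuous_intros) auto
  with psd_form.diag_eq_if_diff_null[OF mu_psd_form[OF assms(5)] assms(1,2)] show ?thesis .
qed

text \<open>
  By locality on Borel sets, the minimum has the energy measure of \<open>u\<close> on \<open>{u \<le> v}\<close> and that of \<open>v\<close>
  on the complement.
\<close>
lemma mu_min_le:
  assumes u: "u \<in> D" "continuous_on UNIV u" and v: "v \<in> D" "continuous_on UNIV v"
    and le: "\<And>B. B \<in> sets borel \<Longrightarrow> \<mu>c u u B \<le> \<nu> B" "\<And>B. B \<in> sets borel \<Longrightarrow> \<mu>c v v B \<le> \<nu> B"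
    and add: "\<And>A B. A \<in> sets borel \<Longrightarrow> B \<in> sets borel \<Longrightarrow> \<nu> (A \<inter> B) + \<nu> (A - B) = \<nu> A"
    and B: "B \<in> sets borel"
  shows "\<mu>c (\<lambda>x. min (u x) (v x)) (\<lambda>x. min (u x) (v x)) B \<le> \<nu> B"
proof -
  let ?w = "\<lambda>x. min (u x) (v x)"
  define C where "C = {x. u x \<le> v x}"
  have C: "C \<in> sets borel" unfolding C_def using u v by (intro borel_closed closed_Collect_le)
  have w: "?w \<in> D" "continuous_on UNIV ?w" using u v by (auto intro: D_min continuous_on_min)
  have "\<mu>c ?w ?w (B \<inter> C) = \<mu>c u u (B \<inter> C)"
    using u w B C by (intro mu_local) (auto simp: C_def)
  moreover have "\<mu>c ?w ?w (B - C) = \<mu>c v v (B - C)"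
    using v w B C by (intro mu_local) (auto simp: C_def)
  ultimately have "\<mu>c ?w ?w B \<le> \<nu> (B \<inter> C) + \<nu> (B - C)"
    using mu_split[OF w(1) B C] le(1)[of "B \<inter> C"] le(2)[of "B - C"] B C by simp
  then show ?thesis using add[OF B C] by simp
qed

text \<open>
  Strong locality makes \<open>\<mu>\<^sup>c(\<theta>, \<eta>)\<close> vanish when \<open>\<theta>\<close> is a cutoff function that is \<open>1\<close> on the support of
  \<open>\<eta>\<close>, and on \<open>B\<close> the functions \<open>\<theta>\<close> and \<open>\<eta>\<close> agree.
\<close>
lemma mu_cutoff_null:
  assumes \<eta>: "\<eta> \<in> D" "\<eta> \<in> C_c" and B: "B \<in> sets borel" "\<And>x. x \<in> B \<Longrightarrow> \<eta> x = 1"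
  shows "\<mu>c \<eta> \<eta> B = 0"
proof -
  interpret mu: psd_form D "\<lambda>u v. \<mu>c u v B" using B(1) by (rule mu_psd_form)
  have "compact (closure {x. \<eta> x \<noteq> 0})" using \<eta>(2) by (simp add: C_c_def)
  then obtain \<theta> where \<theta>: "\<theta> \<in> D" "\<theta> \<in> C_c" "\<forall>x\<in>closure {x. \<eta> x \<noteq> 0}. \<theta> x = 1"
    by (rule cutoff)
  have "\<mu>c \<theta> \<eta> B = 0"
  proof -
    have "AE x in m. x \<in> supp m \<eta> \<longrightarrow> \<theta> x = 1" using \<theta>(3) supp_subset_closure[of m \<eta>] by (intro AE_I2) auto
    moreover have "\<forall>u\<in>D. \<forall>v\<in>D. (\<exists>c. AE x in m. x \<in> supp m v \<longrightarrow> u x = c) \<longrightarrow>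
        (\<forall>B\<in>sets borel. \<mu>c u v B = 0)"
      using strongly_local unfolding strongly_local_energy_form_def by (elim conjE)
    ultimately show ?thesis using \<theta>(1) \<eta>(1) B(1) by blast
  qed
  moreover have "\<mu>c (\<lambda>x. \<theta> x - \<eta> x) (\<lambda>x. \<theta> x - \<eta> x) B = 0"
  proof (rule mu_null)
    fix x assume "x \<in> B"
    then have "\<eta> x = 1" using B(2) by simp
    moreover from this have "x \<in> closure {x. \<eta> x \<noteq> 0}" by (intro subsetD[OF closure_subset]) simp
    ultimately show "\<theta> x - \<eta> x = 0" using \<theta>(3) by simp
  qed (use \<theta> \<eta> B(1) in \<open>auto simp: C_c_def intro!: form.diff_closed continuous_intros\<close>)
  ultimately show ?thesis
    using mu.null_left[OF form.diff_closed[OF \<theta>(1) \<eta>(1)] \<eta>(1)] mu.diff_left[OF \<theta>(1) \<eta>(1) \<eta>(1)] by simp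
qed

text \<open>
  Locally, this is the invariance of the energy measure under the addition of constants.
\<close>
lemma mu_add_cutoff:
  assumes v: "v \<in> D" and \<eta>: "\<eta> \<in> D" "\<eta> \<in> C_c"
    and B: "B \<in> sets borel" "\<And>x. x \<in> B \<Longrightarrow> \<eta> x = 1"
  shows "\<mu>c (\<lambda>x. v x + c * \<eta> x) (\<lambda>x. v x + c * \<eta> x) B = \<mu>c v v B"
proof -
  interpret mu: psd_form D "\<lambda>u v. \<mu>c u v B" using B(1) by (rule mu_psd_form)
  have z: "\<mu>c \<eta> \<eta> B = 0" by (rule mu_cutoff_null[OF \<eta> B])
  show ?thesis
    using mu.lincomb_diag[OF v \<eta>(1), of 1 c] mu.null_left[OF \<eta>(1) v z] mu.sym[OF v \<eta>(1)] z by simp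
qed

subsection \<open>Extension of the energy measures to the local space\<close>

lemma energy_measure_exists:
  assumes "v \<in> D"
  obtains M where "sets M = sets borel" "\<forall>B\<in>sets borel. emeasure M B = ennreal (\<mu>c v v B)"
proof -
  define M where "M = measure_of UNIV (sets borel) (\<lambda>B. ennreal (\<mu>c v v B))"
  have sets: "sets M = sets borel"
    unfolding M_def using sets.sets_measure_of_eq[of borel] by (simp add: sets_measure_of_conv)
  have "emeasure M B = ennreal (\<mu>c v v B)" if "B \<in> sets borel" for B
  proof (rule emeasure_measure_of[OF M_def])
    show "positive (sets M) (\<lambda>B. ennreal (\<mu>c v v B))"
      using signed_measure_empty[OF mu_signed[OF assms]] by (simp add: positive_def)
    show "countably_additive (sets M) (\<lambda>B. ennreal (\<mu>c v v B))"
      unfolding countably_additive_def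
    proof (intro allI impI)
      fix A :: "nat \<Rightarrow> 'a set"
      assume A: "range A \<subseteq> sets M" "disjoint_family A" "\<Union> (range A) \<in> sets M"
      have "(\<lambda>n. \<mu>c v v (A n)) sums \<mu>c v v (\<Union>n. A n)"
        using mu_signed[OF assms] A sets unfolding signed_measure_def by simp
      moreover have "0 \<le> \<mu>c v v (A n)" for n using A(1) sets by (intro mu_nonneg[OF assms]) auto
      moreover have "0 \<le> \<mu>c v v (\<Union>n. A n)" using A(3) sets by (intro mu_nonneg[OF assms]) auto
      ultimately have "(\<lambda>n. ennreal (\<mu>c v v (A n))) sums ennreal (\<mu>c v v (\<Union>n. A n))"
        by (subst sums_ennreal)
      then show "(\<Sum>n. ennreal (\<mu>c v v (A n))) = ennreal (\<mu>c v v (\<Union>n. A n))" by (rule sums_unique[symmetric])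
    qed
  qed (use that sets in auto)
  then show ?thesis using that[of M] sets by simp
qed

text \<open>
  The property whose unique solution \<open>mu_c\<close> is defined to be.
\<close>
definition extends_energy :: "('a \<Rightarrow> real) \<Rightarrow> 'a measure \<Rightarrow> bool" where
  "extends_energy u \<nu> \<longleftrightarrow> sets \<nu> = sets borel \<and>
     (\<forall>G. open G \<longrightarrow> compact (closure G) \<longrightarrow>
        (\<forall>v\<in>D. (AE x in m. x \<in> G \<longrightarrow> u x = v x) \<longrightarrow>
           (\<forall>B\<in>sets borel. B \<subseteq> G \<longrightarrow> emeasure \<nu> B = ennreal (\<mu>c v v B))))"

lemma extends_energyD:
  assumes "extends_energy u \<nu>" "open G" "compact (closure G)" "v \<in> D"
    "AE x in m. x \<in> G \<longrightarrow> u x = v x" "B \<in> sets borel" "B \<subseteq> G"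
  shows "emeasure \<nu> B = ennreal (\<mu>c v v B)"
  using assms(1) unfolding extends_energy_def by (elim conjE) (use assms(2-) in simp)

lemma relatively_compact_partition:
  obtains G P :: "nat \<Rightarrow> 'a set" where "\<forall>n. open (G n)" "\<forall>n. compact (closure (G n))"
    "\<forall>n. P n \<in> sets borel" "\<forall>n. P n \<subseteq> G n" "disjoint_family P" "(\<Union>n. P n) = UNIV"
proof -
  obtain G :: "nat \<Rightarrow> 'a set"
    where G: "\<forall>n. open (G n)" "\<forall>n. compact (closure (G n))" "(\<Union>n. G n) = UNIV"
    using relatively_compact_exhaustion[OF locally_compact] .
  have "range G \<subseteq> sets borel" using G(1) by auto
  then have "range (disjointed G) \<subseteq> sets borel" by (rule sets.range_disjointed_sets)
  then show ?thesis
    using G disjointed_subset[of G] disjoint_family_disjointed[of G] UN_disjointed_eq[of G]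
    by (intro that[of G "disjointed G"]) auto
qed

text \<open>
  The measures \<open>\<mu>\<^sup>c(v\<^sub>n)\<close> of local representatives \<open>v\<^sub>n\<close> of \<open>u\<close> are glued along a countable Borel
  partition into relatively compact pieces.  Locality makes the result independent of the
  representatives.
\<close>
lemma extension_exists:
  assumes u: "u \<in> D_loc m D"
  shows "\<exists>\<nu>. extends_energy u \<nu>"
proof -
  obtain G P :: "nat \<Rightarrow> 'a set" where G: "\<forall>n. open (G n)" "\<forall>n. compact (closure (G n))"
    and P: "\<forall>n. P n \<in> sets borel" "\<forall>n. P n \<subseteq> G n" "disjoint_family P" "(\<Union>n. P n) = UNIV"
    by (rule relatively_compact_partition)
  have "\<forall>n. \<exists>v. v \<in> D \<and> (AE x in m. x \<in> G n \<longrightarrow> u x = v x)"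
    using u G unfolding D_loc_def by blast
  then obtain v where "\<forall>n. v n \<in> D \<and> (AE x in m. x \<in> G n \<longrightarrow> u x = v n x)"
    by (elim choice[THEN exE])
  then have v: "\<And>n. v n \<in> D" "\<And>n. AE x in m. x \<in> G n \<longrightarrow> u x = v n x" by simp_all
  have "\<forall>n. \<exists>M. sets M = sets borel \<and> (\<forall>B\<in>sets borel. emeasure M B = ennreal (\<mu>c (v n) (v n) B))"
  proof
    fix n
    show "\<exists>M. sets M = sets borel \<and> (\<forall>B\<in>sets borel. emeasure M B = ennreal (\<mu>c (v n) (v n) B))"
      by (rule energy_measure_exists[OF v(1)[of n]]) (intro exI conjI)
  qed
  then obtain M where "\<forall>n. sets (M n) = sets borel \<and> (\<forall>B\<in>sets borel. emeasure (M n) B = ennreal (\<mu>c (v n) (v n) B))"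
    by (elim choice[THEN exE])
  then have M: "\<And>n. sets (M n) = sets borel"
    "\<And>n B. B \<in> sets borel \<Longrightarrow> emeasure (M n) B = ennreal (\<mu>c (v n) (v n) B)" by simp_all
  define \<nu> where "\<nu> = measure_of UNIV (sets borel) (\<lambda>B. \<Sum>n. emeasure (M n) (B \<inter> P n))"
  have sets: "sets \<nu> = sets borel"
    unfolding \<nu>_def using sets.sets_measure_of_eq[of borel] by (simp add: sets_measure_of_conv)
  have em: "emeasure \<nu> B = (\<Sum>n. emeasure (M n) (B \<inter> P n))" if "B \<in> sets borel" for B
  proof (rule emeasure_measure_of[OF \<nu>_def])
    show "positive (sets \<nu>) (\<lambda>B. \<Sum>n. emeasure (M n) (B \<inter> P n))" by (simp add: positive_def)
    show "countably_additive (sets \<nu>) (\<lambda>B. \<Sum>n. emeasure (M n) (B \<inter> P n))"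
      unfolding countably_additive_def
    proof (intro allI impI)
      fix A :: "nat \<Rightarrow> 'a set"
      assume A: "range A \<subseteq> sets \<nu>" "disjoint_family A" "\<Union> (range A) \<in> sets \<nu>"
      have "(\<Sum>i. emeasure (M n) (A i \<inter> P n)) = emeasure (M n) ((\<Union>i. A i) \<inter> P n)" for n
      proof -
        have "(\<Sum>i. emeasure (M n) (A i \<inter> P n)) = emeasure (M n) (\<Union>i. A i \<inter> P n)"
        proof (rule suminf_emeasure)
          show "range (\<lambda>i. A i \<inter> P n) \<subseteq> sets (M n)" using A(1) P(1) sets M(1) by auto
          show "disjoint_family (\<lambda>i. A i \<inter> P n)"
            using A(2) by (auto simp: disjoint_family_on_def)
        qed
        also have "(\<Union>i. A i \<inter> P n) = (\<Union>i. A i) \<inter> P n" by blast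
        finally show ?thesis .
      qed
      then show "(\<Sum>i. \<Sum>n. emeasure (M n) (A i \<inter> P n)) = (\<Sum>n. emeasure (M n) ((\<Union>i. A i) \<inter> P n))"
        by (subst ennreal_suminf_swap) simp
    qed
  qed (use that sets in auto)
  have "extends_energy u \<nu>"
    unfolding extends_energy_def
  proof (intro conjI allI impI ballI)
    fix H w B
    assume H: "open H" "compact (closure H)" "w \<in> D" "AE x in m. x \<in> H \<longrightarrow> u x = w x"
      and B: "B \<in> sets borel" "B \<subseteq> H"
    obtain N where N: "sets N = sets borel" "\<forall>B\<in>sets borel. emeasure N B = ennreal (\<mu>c w w B)"
      using energy_measure_exists[OF H(3)] .
    have BP: "B \<inter> P n \<in> sets borel" for n using B(1) P(1) by auto
    have "emeasure (M n) (B \<inter> P n) = emeasure N (B \<inter> P n)" for n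
    proof -
      have "\<mu>c (v n) (v n) (B \<inter> P n) = \<mu>c w w (B \<inter> P n)"
      proof (rule mu_open_local[OF v(1) H(3) _ _ BP])
        show "open (G n \<inter> H)" using G(1) H(1) by auto
        show "AE x in m. x \<in> G n \<inter> H \<longrightarrow> v n x = w x" using v(2)[of n] H(4) by eventually_elim auto
        show "B \<inter> P n \<subseteq> G n \<inter> H" using B(2) P(2) by auto
      qed
      then show ?thesis using M(2) N(2) BP by simp
    qed
    then have "emeasure \<nu> B = (\<Sum>n. emeasure N (B \<inter> P n))" using em[OF B(1)] by simp
    also have "\<dots> = emeasure N (\<Union>n. B \<inter> P n)"
    proof (rule suminf_emeasure)
      show "range (\<lambda>n. B \<inter> P n) \<subseteq> sets N" using BP N(1) by auto
      show "disjoint_family (\<lambda>n. B \<inter> P n)" using P(3) by (auto simp: disjoint_family_on_def)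
    qed
    also have "(\<Union>n. B \<inter> P n) = B" using P(4) by auto
    finally show "emeasure \<nu> B = ennreal (\<mu>c w w B)" using N(2) B(1) by simp
  qed (rule sets)
  then show ?thesis by (rule exI)
qed

lemma extension_unique:
  assumes u: "u \<in> D_loc m D" and \<nu>: "extends_energy u \<nu>" and \<nu>': "extends_energy u \<nu>'"
  shows "\<nu> = \<nu>'"
proof -
  obtain G P :: "nat \<Rightarrow> 'a set" where G: "\<forall>n. open (G n)" "\<forall>n. compact (closure (G n))"
    and P: "\<forall>n. P n \<in> sets borel" "\<forall>n. P n \<subseteq> G n" "disjoint_family P" "(\<Union>n. P n) = UNIV"
    by (rule relatively_compact_partition)
  have s: "sets \<nu> = sets borel" "sets \<nu>' = sets borel" using \<nu> \<nu>' by (simp_all add: extends_energy_def)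
  show ?thesis
  proof (rule measure_eqI)
    fix B assume "B \<in> sets \<nu>"
    then have B: "B \<in> sets borel" using s by simp
    have "emeasure \<nu> (B \<inter> P n) = emeasure \<nu>' (B \<inter> P n)" for n
    proof -
      obtain v where v: "v \<in> D" "AE x in m. x \<in> G n \<longrightarrow> u x = v x"
        using u G unfolding D_loc_def by blast
      have "B \<inter> P n \<in> sets borel" "B \<inter> P n \<subseteq> G n" using B P by auto
      with v G show ?thesis
        using extends_energyD[OF \<nu>, of "G n" v "B \<inter> P n"] extends_energyD[OF \<nu>', of "G n" v "B \<inter> P n"] by simp
    qed
    then show "emeasure \<nu> B = emeasure \<nu>' B"
      using emeasure_eq_suminf_partition[OF s(1) B P(1,3,4)] emeasure_eq_suminf_partition[OF s(2) B P(1,3,4)]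
      by simp
  qed (use s in simp)
qed

lemma mu_c_extends:
  assumes "u \<in> D_loc m D"
  shows "extends_energy u (mu_c m D \<mu>c u)"
proof -
  have "mu_c m D \<mu>c u = (THE \<nu>. extends_energy u \<nu>)" unfolding mu_c_def extends_energy_def ..
  moreover have "\<exists>!\<nu>. extends_energy u \<nu>"
    using extension_exists[OF assms] extension_unique[OF assms] by (rule ex_ex1I)
  ultimately show ?thesis using theI'[of "extends_energy u"] by simp
qed

lemma mu_c_le_if_locally_le:
  assumes u: "u \<in> D_loc m D" and M: "sets M = sets borel"
    and le: "\<And>G. open G \<Longrightarrow> compact (closure G) \<Longrightarrow> \<exists>v\<in>D. (AE x in m. x \<in> G \<longrightarrow> u x = v x) \<and>
        (\<forall>B\<in>sets borel. B \<subseteq> G \<longrightarrow> ennreal (\<mu>c v v B) \<le> emeasure M B)"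
    and B: "B \<in> sets borel"
  shows "emeasure (mu_c m D \<mu>c u) B \<le> emeasure M B"
proof -
  let ?\<nu> = "mu_c m D \<mu>c u"
  have \<nu>: "extends_energy u ?\<nu>" by (rule mu_c_extends[OF u])
  then have s: "sets ?\<nu> = sets borel" by (simp add: extends_energy_def)
  obtain G P :: "nat \<Rightarrow> 'a set" where G: "\<forall>n. open (G n)" "\<forall>n. compact (closure (G n))"
    and P: "\<forall>n. P n \<in> sets borel" "\<forall>n. P n \<subseteq> G n" "disjoint_family P" "(\<Union>n. P n) = UNIV"
    by (rule relatively_compact_partition)
  have "emeasure ?\<nu> (B \<inter> P n) \<le> emeasure M (B \<inter> P n)" for n
  proof -
    obtain v where v: "v \<in> D" "AE x in m. x \<in> G n \<longrightarrow> u x = v x"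
      "\<forall>B\<in>sets borel. B \<subseteq> G n \<longrightarrow> ennreal (\<mu>c v v B) \<le> emeasure M B"
      using le[OF G(1)[rule_format] G(2)[rule_format], of n] by (elim bexE conjE)
    have BP: "B \<inter> P n \<in> sets borel" "B \<inter> P n \<subseteq> G n" using B P by auto
    have "emeasure ?\<nu> (B \<inter> P n) = ennreal (\<mu>c v v (B \<inter> P n))"
      using G by (intro extends_energyD[OF \<nu> _ _ v(1,2) BP]) auto
    then show ?thesis using v(3) BP by simp
  qed
  then show ?thesis
    unfolding emeasure_eq_suminf_partition[OF s B P(1,3,4)] emeasure_eq_suminf_partition[OF M B P(1,3,4)]
    by (intro suminf_le) auto
qed

subsection \<open>Continuous functions and the jump part\<close>

lemma continuous_L2_loc:
  assumes "continuous_on UNIV f"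
  shows "f \<in> L2_loc m"
proof -
  have "set_integrable m K (\<lambda>x. (f x)\<^sup>2)" if K: "compact K" for K
  proof -
    have "compact (f ` K)"
      using continuous_on_subset[OF assms subset_UNIV] K by (rule compact_continuous_image)
    then obtain a where a: "0 < a" "\<forall>y\<in>f ` K. norm y \<le> a"
      using compact_imp_bounded bounded_pos by metis
    have Kb: "K \<in> sets m" using K sets_m by (simp add: borel_closed compact_imp_closed)
    have "emeasure m K < \<infinity>" using radon K by (simp add: radon_measure_def)
    then have int: "integrable m (\<lambda>x. indicator K x *\<^sub>R a\<^sup>2)"
      using Kb by (intro integrable_scaleR_left integrable_real_indicator) auto
    have "integrable m (\<lambda>x. indicator K x *\<^sub>R (f x)\<^sup>2)"
    proof (rule Bochner_Integration.integrable_bound[OF int])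
      have "f \<in> borel_measurable m" using borel_measurable_continuous_onI[OF assms] by simp
      then show "(\<lambda>x. indicator K x *\<^sub>R (f x)\<^sup>2) \<in> borel_measurable m" using Kb by measurable
      have "(f x)\<^sup>2 \<le> a\<^sup>2" if "x \<in> K" for x
        using a that power_mono[of "\<bar>f x\<bar>" a 2] by auto
      then show "AE x in m. norm (indicator K x *\<^sub>R (f x)\<^sup>2) \<le> norm (indicator K x *\<^sub>R a\<^sup>2)"
        by (intro AE_I2) (simp add: indicator_def)
    qed
    then show ?thesis by (simp add: set_integrable_def)
  qed
  then show ?thesis
    using borel_measurable_continuous_onI[OF assms] by (simp add: L2_loc_def)
qed

lemma zero_energy: "E (\<lambda>x. 0) (\<lambda>x. 0) = 0"
  using form.scale_left[OF D_zero D_zero, of 0] by simp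

text \<open>
  The empty set, which has capacity \<open>0\<close>, serves as the exceptional set for every \<open>e\<close>.
\<close>
lemma qc_rep_continuous:
  assumes "continuous_on UNIV u"
  shows "qc_rep m D E u = u"
proof -
  have "quasi_continuous m D E u"
    unfolding quasi_continuous_def
  proof (intro allI impI exI[of _ "{}"] conjI)
    fix e :: real assume "0 < e"
    have "capacity_open m D E {} \<le> ennreal (E1 m E (\<lambda>x. 0))"
      unfolding capacity_open_def using D_zero by (intro INF_lower) simp
    also have "\<dots> = 0" using zero_energy by (simp add: E1_def)
    finally show "capacity_open m D E {} < ennreal e" using \<open>0 < e\<close> by (simp add: le_zero_eq)
  qed (use assms in auto)
  moreover have "u \<in> borel_measurable borel" using assms by (rule borel_measurable_continuous_onI)
  ultimately show ?thesis unfolding qc_rep_def by simp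
qed

lemma jump: "jump_measure J"
  using decomposition by (simp add: beurling_deny_def)

lemma sets_J [measurable_cong]: "sets J = sets borel"
  using jump by (simp add: jump_measure_def)

lemma borel_measurable_J [simp]: "borel_measurable J = borel_measurable borel"
  by (rule measurable_cong_sets) (auto simp: sets_J)

lemma space_J [simp]: "space J = UNIV"
  using sets_eq_imp_space_eq[OF sets_J] by simp

lemma nn_integral_swap:
  assumes "f \<in> borel_measurable (borel :: ('a \<times> 'a) measure)"
  shows "(\<integral>\<^sup>+p. f (prod.swap p) \<partial>J) = (\<integral>\<^sup>+p. f p \<partial>J)"
proof -
  have m: "prod.swap \<in> J \<rightarrow>\<^sub>M (borel :: ('a \<times> 'a) measure)"
    using swap_borel measurable_cong_sets[OF sets_J refl] by blast
  have "distr J borel prod.swap = J"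
  proof (rule measure_eqI)
    fix B assume "B \<in> sets (distr J borel prod.swap)"
    then have B: "B \<in> sets borel" by simp
    then show "emeasure (distr J borel prod.swap) B = emeasure J B"
      using jump by (simp add: emeasure_distr[OF m] jump_measure_def)
  qed (simp add: sets_J)
  then have "(\<integral>\<^sup>+p. f p \<partial>J) = (\<integral>\<^sup>+p. f p \<partial>distr J borel prod.swap)" by simp
  also have "\<dots> = (\<integral>\<^sup>+p. f (prod.swap p) \<partial>J)" by (rule nn_integral_distr[OF m]) (use assms in simp)
  finally show ?thesis by simp
qed

abbreviation increment :: "('a \<Rightarrow> real) \<Rightarrow> 'a \<times> 'a \<Rightarrow> ennreal" where
  "increment u p \<equiv> ennreal ((u (fst p) - u (snd p))\<^sup>2)"

lemma increment_borel [measurable]: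
  assumes "continuous_on UNIV u"
  shows "increment u \<in> borel_measurable (borel :: ('a \<times> 'a) measure)"
proof -
  have "continuous_on UNIV (\<lambda>p :: 'a \<times> 'a. u (fst p))" "continuous_on UNIV (\<lambda>p :: 'a \<times> 'a. u (snd p))"
    using continuous_on_compose2[OF assms continuous_on_fst[OF continuous_on_id]]
      continuous_on_compose2[OF assms continuous_on_snd[OF continuous_on_id]] by simp_all
  then have "continuous_on UNIV (\<lambda>p :: 'a \<times> 'a. (u (fst p) - u (snd p))\<^sup>2)"
    by (intro continuous_on_power continuous_on_diff)
  then have "(\<lambda>p. (u (fst p) - u (snd p))\<^sup>2) \<in> borel_measurable (borel :: ('a \<times> 'a) measure)"
    by (rule borel_measurable_continuous_onI)
  then show ?thesis by measurable
qed

lemma mu_b_continuous: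
  assumes "continuous_on UNIV u"
  shows "mu_b m D E J u B = (\<integral>\<^sup>+p. increment u p * indicator (B \<times> UNIV - diag) p \<partial>J)"
  unfolding mu_b_def qc_rep_continuous[OF assms] by (simp add: case_prod_beta')

lemma energy_continuous:
  assumes "u \<in> D" "continuous_on UNIV u"
  shows "ennreal (E u u) = (\<integral>\<^sup>+p. increment u p * indicator (- diag) p \<partial>J)
      + ennreal (\<mu>c u u UNIV) + (\<integral>\<^sup>+x. ennreal ((u x)\<^sup>2) \<partial>k)"
  using beurling_deny_formula[OF assms(1)]
  unfolding qc_rep_continuous[OF assms(2)] by (simp add: case_prod_beta')

text \<open>
  The region where \<open>x \<in> S\<close> or \<open>y \<in> S\<close> is covered by \<open>S \<times> X\<close> and its mirror image, which contribute
  equally by the symmetry of \<open>J\<close>; this explains the factor 2.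
\<close>
lemma jump_energy_le:
  assumes cont: "continuous_on UNIV w" "continuous_on UNIV g" "continuous_on UNIV \<eta>"
    and S: "S \<in> sets borel"
    and le: "\<And>x y. (w x - w y)\<^sup>2 \<le> (if x \<in> S \<or> y \<in> S then (g x - g y)\<^sup>2 else 0) + c * (\<eta> x - \<eta> y)\<^sup>2"
    and c: "0 \<le> c"
  shows "(\<integral>\<^sup>+p. increment w p * indicator (- diag) p \<partial>J) \<le> 2 * mu_b m D E J g S
      + ennreal c * (\<integral>\<^sup>+p. increment \<eta> p * indicator (- diag) p \<partial>J)"
proof -
  define F where "F p = increment g p * indicator (S \<times> UNIV - diag) p" for p
  have [measurable]: "S \<times> UNIV \<in> sets (borel :: ('a \<times> 'a) measure)" using S by (simp add: borel_Times)
  have F [measurable]: "F \<in> borel_measurable borel"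
    unfolding F_def using increment_borel[OF cont(2)] by measurable
  have Fs [measurable]: "(\<lambda>p. F (prod.swap p)) \<in> borel_measurable borel"
    using measurable_compose[OF swap_borel F] .
  have H [measurable]: "(\<lambda>p. increment \<eta> p * indicator (- diag) p) \<in> borel_measurable borel"
    using increment_borel[OF cont(3)] by measurable
  have "increment w p * indicator (- diag) p
      \<le> F p + F (prod.swap p) + ennreal c * (increment \<eta> p * indicator (- diag) p)" for p
  proof (cases p)
    case (Pair x y)
    have "ennreal ((w x - w y)\<^sup>2) \<le> (if x \<in> S \<or> y \<in> S then ennreal ((g x - g y)\<^sup>2) else 0)
        + ennreal c * ennreal ((\<eta> x - \<eta> y)\<^sup>2)"
      using ennreal_leI[OF le[of x y]] c by (auto simp: ennreal_plus ennreal_mult split: if_splits)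
    moreover have "(g y - g x)\<^sup>2 = (g x - g y)\<^sup>2" by (rule power2_commute)
    ultimately show ?thesis
      unfolding Pair F_def by (auto simp: indicator_def add.assoc split: if_splits intro: order_trans)
  qed
  then have "(\<integral>\<^sup>+p. increment w p * indicator (- diag) p \<partial>J)
      \<le> (\<integral>\<^sup>+p. F p + F (prod.swap p) + ennreal c * (increment \<eta> p * indicator (- diag) p) \<partial>J)"
    by (intro nn_integral_mono)
  also have "\<dots> = (\<integral>\<^sup>+p. F p \<partial>J) + (\<integral>\<^sup>+p. F (prod.swap p) \<partial>J)
      + ennreal c * (\<integral>\<^sup>+p. increment \<eta> p * indicator (- diag) p \<partial>J)"
    using F Fs H by (simp add: nn_integral_add nn_integral_cmult)
  also have "(\<integral>\<^sup>+p. F (prod.swap p) \<partial>J) = (\<integral>\<^sup>+p. F p \<partial>J)" by (rule nn_integral_swap[OF F])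
  also have "(\<integral>\<^sup>+p. F p \<partial>J) = mu_b m D E J g S" unfolding F_def mu_b_continuous[OF cont(2)] ..
  finally show ?thesis by (simp add: mult_2)
qed

end


section \<open>Lipschitz functions of an intrinsic metric\<close>

lemma ennreal_abs_diff_le:
  assumes "ennreal a \<le> r + ennreal b" "ennreal b \<le> r + ennreal a" "0 \<le> a" "0 \<le> b"
  shows "ennreal \<bar>a - b\<bar> \<le> r"
proof (cases r)
  case (real t)
  with assms have "a \<le> t + b" "b \<le> t + a" by (simp_all flip: ennreal_plus)
  then show ?thesis unfolding real by (intro ennreal_leI) linarith
qed simp

lemma square_min_diff_le:
  fixes a a' b b' :: real
  shows "(min a b - min a' b')\<^sup>2 \<le> (a - a')\<^sup>2 + (b - b')\<^sup>2"
proof -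
  have "\<bar>min a b - min a' b'\<bar> \<le> max \<bar>a - a'\<bar> \<bar>b - b'\<bar>" by (simp add: min_def max_def abs_if)
  then have "\<bar>min a b - min a' b'\<bar> \<le> \<bar>a - a'\<bar> \<or> \<bar>min a b - min a' b'\<bar> \<le> \<bar>b - b'\<bar>"
    by (simp add: le_max_iff_disj)
  then show ?thesis
    unfolding abs_le_square_iff using zero_le_power2[of "a - a'"] zero_le_power2[of "b - b'"] by linarith
qed

lemma dense_sequence:
  obtains y :: "nat \<Rightarrow> 'a::second_countable_topology" where "\<forall>U. open U \<longrightarrow> U \<noteq> {} \<longrightarrow> (\<exists>i. y i \<in> U)"
proof -
  obtain C :: "'a set" where C: "countable C" "\<And>U. open U \<Longrightarrow> U \<noteq> {} \<Longrightarrow> \<exists>d\<in>C. d \<in> U"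
    using countable_dense_setE by blast
  have "C \<noteq> {}" using C(2)[of UNIV] by auto
  then have "range (from_nat_into C) = C" using C(1) by (rule range_from_nat_into)
  then show ?thesis using C(2) by (intro that[of "from_nat_into C"]) (metis rangeE)
qed

locale intrinsic_metric_form = beurling_deny_form m k D E J \<mu>c
  for m k :: "'a::{metric_space, second_countable_topology} measure"
    and D :: "('a \<Rightarrow> real) set"
    and E :: "('a \<Rightarrow> real) \<Rightarrow> ('a \<Rightarrow> real) \<Rightarrow> real"
    and J :: "('a \<times> 'a) measure"
    and \<mu>c :: "('a \<Rightarrow> real) \<Rightarrow> ('a \<Rightarrow> real) \<Rightarrow> 'a set \<Rightarrow> real" +
  fixes \<rho> :: "'a \<Rightarrow> 'a \<Rightarrow> ennreal" and mb mc :: "'a measure"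
  assumes pseudo_metric: "pseudo_metric \<rho>"
    and admissible: "admissible_pair m mb mc"
    and cut_D_loc_star: "T > 0 \<Longrightarrow> pm_setdist_cut \<rho> A T \<in> D_loc_star m D E J"
    and cut_continuous: "T > 0 \<Longrightarrow> continuous_on UNIV (pm_setdist_cut \<rho> A T)"
    and cut_bounded: "T > 0 \<Longrightarrow> energy_bounded m D E J \<mu>c mb mc (pm_setdist_cut \<rho> A T)"
begin

abbreviation Lip :: "('a \<Rightarrow> real) set" where
  "Lip \<equiv> {f. \<forall>x y. ennreal \<bar>f x - f y\<bar> \<le> \<rho> x y}"

lemma rho_refl [simp]: "\<rho> x x = 0"
  using pseudo_metric by (simp add: pseudo_metric_def)

lemma rho_sym: "\<rho> x y = \<rho> y x"
  using pseudo_metric by (simp add: pseudo_metric_def)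

lemma rho_triangle: "\<rho> x z \<le> \<rho> x y + \<rho> y z"
  using pseudo_metric by (simp add: pseudo_metric_def)

lemma ennreal_cut: "ennreal (pm_setdist_cut \<rho> A T x) = min (INF y\<in>A. \<rho> x y) (ennreal T)"
  unfolding pm_setdist_cut_def pm_setdist_def
  by (rule ennreal_enn2real) (simp add: min_less_iff_disj)

lemma ennreal_cut_point: "ennreal (pm_setdist_cut \<rho> {y} T x) = min (\<rho> x y) (ennreal T)"
  by (simp add: ennreal_cut)

lemma cut_nonneg: "0 \<le> pm_setdist_cut \<rho> A T x"
  by (simp add: pm_setdist_cut_def)

lemma cut_point_Lip: "pm_setdist_cut \<rho> {y} T \<in> Lip"
proof (clarify)
  fix x z
  have *: "min (\<rho> x y) (ennreal T) \<le> \<rho> x z + min (\<rho> z y) (ennreal T)" for x z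
    using rho_triangle[of x y z] by (auto simp: min_def add_increasing intro: order_trans)
  show "ennreal \<bar>pm_setdist_cut \<rho> {y} T x - pm_setdist_cut \<rho> {y} T z\<bar> \<le> \<rho> x z"
    using *[of x z] *[of z x]
    by (intro ennreal_abs_diff_le) (simp_all add: ennreal_cut_point cut_nonneg rho_sym[of z x])
qed

lemma open_rho_ball:
  assumes "0 < e"
  shows "open {x. \<rho> x y < ennreal e}"
proof -
  have "\<rho> x y < ennreal e \<longleftrightarrow> pm_setdist_cut \<rho> {y} e x < e" for x
  proof -
    have "pm_setdist_cut \<rho> {y} e x < e \<longleftrightarrow> ennreal (pm_setdist_cut \<rho> {y} e x) < ennreal e"
      using cut_nonneg by (simp add: ennreal_less_iff)
    then show ?thesis by (auto simp: ennreal_cut_point min_def)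
  qed
  then have "{x. \<rho> x y < ennreal e} = {x. pm_setdist_cut \<rho> {y} e x < e}" by simp
  then show ?thesis
    using open_Collect_less[OF cut_continuous[OF assms] continuous_on_const] by simp
qed

lemma Lip_continuous:
  assumes "f \<in> Lip"
  shows "continuous_on UNIV f"
proof -
  have "(f \<longlongrightarrow> f x) (at x)" for x
  proof (rule tendstoI)
    fix e :: real assume e: "0 < e"
    have "dist (f z) (f x) < e" if "\<rho> z x < ennreal e" for z
    proof -
      have "ennreal \<bar>f z - f x\<bar> < ennreal e" using assms that by (auto intro: le_less_trans)
      then show ?thesis by (simp add: dist_real_def ennreal_less_iff)
    qed
    then show "\<forall>\<^sub>F z in at x. dist (f z) (f x) < e"
      unfolding eventually_at_topological using open_rho_ball[OF e, of x] e
      by (intro exI[of _ "{z. \<rho> z x < ennreal e}"]) simp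
  qed
  then show ?thesis by (simp add: continuous_on_def)
qed

subsection \<open>The jump part\<close>

lemma sets_mb: "sets mb = sets borel" and sets_mc: "sets mc = sets borel"
  using admissible by (simp_all add: admissible_pair_def radon_measure_def)

text \<open>
  The pieces \<open>P\<^sub>i\<close> are parts of \<open>\<rho>\<close>-balls of radius \<open>\<epsilon>/2\<close> around a dense sequence.  For \<open>x \<in> P\<^sub>i\<close> and
  arbitrary \<open>z\<close>, passing through a point of \<open>P\<^sub>i\<close> costs at most \<open>\<epsilon>\<close>, so
  \<open>\<bar>f x - f z\<bar> \<and> T - \<epsilon> \<le> \<rho>\<^sub>P\<^sub>i(z) \<and> T\<close> while \<open>\<rho>\<^sub>P\<^sub>i(x) = 0\<close>.  Fatou's lemma removes \<open>\<epsilon> = 1/n\<close> and \<open>T = n\<close>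
  (with \<open>n + 1\<close> in place of \<open>n\<close>).
\<close>
lemma Lip_mu_b_le:
  assumes f: "f \<in> Lip" and B: "B \<in> sets borel"
  shows "mu_b m D E J f B \<le> emeasure mb B"
proof -
  note fc = Lip_continuous[OF f]
  define g where "g n p = max 0 (min \<bar>f (fst p) - f (snd p)\<bar> (real (Suc n)) - 1 / Suc n)" for n p
  have fp: "continuous_on UNIV (\<lambda>p :: 'a \<times> 'a. f (fst p))" "continuous_on UNIV (\<lambda>p :: 'a \<times> 'a. f (snd p))"
    using continuous_on_compose2[OF fc continuous_on_fst[OF continuous_on_id]]
      continuous_on_compose2[OF fc continuous_on_snd[OF continuous_on_id]] by simp_all
  have [measurable]: "g n \<in> borel_measurable (borel :: ('a \<times> 'a) measure)" for n
    unfolding g_def using fp by (intro borel_measurable_continuous_onI continuous_intros)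
  have [measurable]: "C \<times> UNIV - diag \<in> sets (borel :: ('a \<times> 'a) measure)" if "C \<in> sets borel" for C :: "'a set"
    using that by (intro sets.Diff borel_Times diag_borel) auto
  have step: "(\<integral>\<^sup>+p. ennreal ((g n p)\<^sup>2) * indicator (B \<times> UNIV - diag) p \<partial>J) \<le> emeasure mb B" for n
  proof -
    define \<epsilon> where "\<epsilon> = 1 / real (Suc n)"
    define T where "T = real (Suc n)"
    have \<epsilon>: "\<epsilon> > 0" and T: "T > 0" by (simp_all add: \<epsilon>_def T_def)
    obtain y :: "nat \<Rightarrow> 'a" where y: "\<forall>U. open U \<longrightarrow> U \<noteq> {} \<longrightarrow> (\<exists>i. y i \<in> U)"
      using dense_sequence .
    define U where "U i = {x. \<rho> x (y i) < ennreal (\<epsilon> / 2)}" for i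
    have U: "U i \<in> sets borel" for i unfolding U_def using \<epsilon> by (intro borel_open open_rho_ball) simp
    have cover: "(\<Union>i. U i) = UNIV"
    proof -
      have "x \<in> (\<Union>i. U i)" for x
      proof -
        have "open {z. \<rho> z x < ennreal (\<epsilon> / 2)}" "x \<in> {z. \<rho> z x < ennreal (\<epsilon> / 2)}"
          using open_rho_ball[of "\<epsilon> / 2" x] \<epsilon> by simp_all
        then obtain i where "y i \<in> {z. \<rho> z x < ennreal (\<epsilon> / 2)}" using y by blast
        then have "x \<in> U i" unfolding U_def mem_Collect_eq rho_sym[of x "y i"] .
        then show ?thesis by blast
      qed
      then show ?thesis by auto
    qed
    define P where "P i = B \<inter> disjointed U i" for i
    have P: "P i \<in> sets borel" for i
    proof -
      have "range U \<subseteq> sets borel" using U by auto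
      then have "range (disjointed U) \<subseteq> sets borel" by (rule sets.range_disjointed_sets)
      then show ?thesis unfolding P_def using B by auto
    qed
    have PU: "(\<Union>i. P i) = B" unfolding P_def using cover UN_disjointed_eq[of U] by auto
    have disj: "disjoint_family P"
      using disjoint_family_disjointed[of U] unfolding P_def disjoint_family_on_def by blast
    have le: "g n (x, z) \<le> \<bar>pm_setdist_cut \<rho> (P i) T x - pm_setdist_cut \<rho> (P i) T z\<bar>" if x: "x \<in> P i" for i x z
    proof -
      have "(INF v\<in>P i. \<rho> x v) \<le> 0" using x by (intro INF_lower2[of x]) auto
      then have "(INF v\<in>P i. \<rho> x v) = 0" by simp
      then have zero: "pm_setdist_cut \<rho> (P i) T x = 0"
        unfolding pm_setdist_cut_def pm_setdist_def using T by (simp add: min_def)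
      have "ennreal (min \<bar>f x - f z\<bar> T - \<epsilon>) \<le> ennreal (pm_setdist_cut \<rho> (P i) T z)"
        unfolding ennreal_cut
      proof (intro min.boundedI INF_greatest)
        fix v assume v: "v \<in> P i"
        have "\<rho> x v \<le> \<rho> x (y i) + \<rho> (y i) v" by (rule rho_triangle)
        also have "\<dots> \<le> ennreal (\<epsilon> / 2) + ennreal (\<epsilon> / 2)"
          using x v disjointed_subset[of U i] rho_sym[of "y i" v]
          unfolding P_def U_def by (intro add_mono) (auto intro: less_imp_le)
        also have "\<dots> = ennreal \<epsilon>" using \<epsilon> by (simp flip: ennreal_plus)
        finally have "\<rho> x z \<le> ennreal \<epsilon> + \<rho> z v"
          using rho_triangle[of x z v] rho_sym[of v z] by (metis add_right_mono order_trans)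
        moreover have "ennreal \<bar>f x - f z\<bar> \<le> \<rho> x z" using f by simp
        ultimately have le: "ennreal \<bar>f x - f z\<bar> \<le> ennreal \<epsilon> + \<rho> z v" by (rule order_trans[rotated])
        show "ennreal (min \<bar>f x - f z\<bar> T - \<epsilon>) \<le> \<rho> z v"
        proof (cases "\<rho> z v")
          case (real t)
          with le \<epsilon> have "\<bar>f x - f z\<bar> \<le> \<epsilon> + t" by (simp flip: ennreal_plus)
          then show ?thesis unfolding real by (intro ennreal_leI) simp
        qed simp
      qed (use \<epsilon> in \<open>auto intro!: ennreal_leI simp: min_def\<close>)
      then have "min \<bar>f x - f z\<bar> T - \<epsilon> \<le> pm_setdist_cut \<rho> (P i) T z"
        using cut_nonneg by (simp add: ennreal_le_iff)
      then show ?thesis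
        unfolding g_def zero using cut_nonneg[of "P i" T z] by (simp add: \<epsilon>_def T_def)
    qed
    have piece: "(\<integral>\<^sup>+p. ennreal ((g n p)\<^sup>2) * indicator (P i \<times> UNIV - diag) p \<partial>J) \<le> emeasure mb (P i)" for i
    proof -
      have "(\<integral>\<^sup>+p. ennreal ((g n p)\<^sup>2) * indicator (P i \<times> UNIV - diag) p \<partial>J)
          \<le> (\<integral>\<^sup>+p. increment (pm_setdist_cut \<rho> (P i) T) p * indicator (P i \<times> UNIV - diag) p \<partial>J)"
      proof (rule nn_integral_mono)
        fix p
        show "ennreal ((g n p)\<^sup>2) * indicator (P i \<times> UNIV - diag) p
          \<le> increment (pm_setdist_cut \<rho> (P i) T) p * indicator (P i \<times> UNIV - diag) p"
        proof (cases "fst p \<in> P i")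
          case True
          have "0 \<le> g n p" by (simp add: g_def)
          then have "\<bar>g n p\<bar> \<le> \<bar>pm_setdist_cut \<rho> (P i) T (fst p) - pm_setdist_cut \<rho> (P i) T (snd p)\<bar>"
            using le[OF True, of "snd p"] by simp
          then have "(g n p)\<^sup>2 \<le> (pm_setdist_cut \<rho> (P i) T (fst p) - pm_setdist_cut \<rho> (P i) T (snd p))\<^sup>2"
            by (simp only: abs_le_square_iff)
          then show ?thesis by (intro mult_right_mono ennreal_leI) auto
        qed (auto simp: indicator_def)
      qed
      also have "\<dots> = mu_b m D E J (pm_setdist_cut \<rho> (P i) T) (P i)"
        by (rule mu_b_continuous[OF cut_continuous[OF T], symmetric])
      also have "\<dots> \<le> emeasure mb (P i)"
        using cut_bounded[OF T] P unfolding energy_bounded_def by blast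
      finally show ?thesis .
    qed
    have dj: "disjoint_family (\<lambda>i. P i \<times> UNIV - (diag :: ('a \<times> 'a) set))"
      using disj unfolding disjoint_family_on_def by blast
    have "B \<times> UNIV - diag = (\<Union>i. P i \<times> UNIV - diag)" using PU by auto
    then have "(\<integral>\<^sup>+p. ennreal ((g n p)\<^sup>2) * indicator (B \<times> UNIV - diag) p \<partial>J)
        = (\<Sum>i. \<integral>\<^sup>+p. ennreal ((g n p)\<^sup>2) * indicator (P i \<times> UNIV - diag) p \<partial>J)"
      using P by (simp only:) (rule nn_integral_disjoint_family[OF _ _ dj], simp_all add: sets_J)
    also have "\<dots> \<le> (\<Sum>i. emeasure mb (P i))" using piece by (intro suminf_le) auto
    also have "\<dots> = emeasure mb B"
      unfolding PU[symmetric] using P disj sets_mb by (intro suminf_emeasure) auto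
    finally show ?thesis .
  qed
  have lim: "(\<lambda>n. ennreal ((g n p)\<^sup>2) * indicator (B \<times> UNIV - diag) p)
      \<longlonglongrightarrow> increment f p * indicator (B \<times> UNIV - diag) p" for p
  proof -
    define a where "a = \<bar>f (fst p) - f (snd p)\<bar>"
    have d: "(\<lambda>n. 1 / real (Suc n)) \<longlonglongrightarrow> 0" by (rule LIMSEQ_Suc[OF lim_1_over_n])
    obtain N :: nat where N: "a \<le> real N" using real_arch_simple by blast
    have "(\<lambda>n. max 0 (a - 1 / real (Suc n))) \<longlonglongrightarrow> max 0 (a - 0)"
      by (intro tendsto_max tendsto_diff tendsto_const d)
    moreover have "\<forall>\<^sub>F n in sequentially. max 0 (a - 1 / real (Suc n)) = g n p"
      using N by (intro eventually_sequentiallyI[of N]) (simp add: g_def a_def[symmetric] min_def)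
    ultimately have "(\<lambda>n. g n p) \<longlonglongrightarrow> max 0 (a - 0)" by (rule Lim_transform_eventually)
    then have "(\<lambda>n. g n p) \<longlonglongrightarrow> a" by (simp add: a_def)
    then have "(\<lambda>n. (g n p)\<^sup>2) \<longlonglongrightarrow> a\<^sup>2" by (rule tendsto_power)
    then have "(\<lambda>n. ennreal ((g n p)\<^sup>2)) \<longlonglongrightarrow> increment f p" by (simp add: a_def)
    then show ?thesis by (intro tendsto_mult_ennreal tendsto_const) (auto simp: indicator_def)
  qed
  have "mu_b m D E J f B = (\<integral>\<^sup>+p. liminf (\<lambda>n. ennreal ((g n p)\<^sup>2) * indicator (B \<times> UNIV - diag) p) \<partial>J)"
    unfolding mu_b_continuous[OF fc] using lim_imp_Liminf[OF sequentially_bot lim] by simp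
  also have "\<dots> \<le> liminf (\<lambda>n. \<integral>\<^sup>+p. ennreal ((g n p)\<^sup>2) * indicator (B \<times> UNIV - diag) p \<partial>J)"
    using B by (intro nn_integral_liminf) simp
  also have "\<dots> \<le> emeasure mb B"
    using step by (intro Liminf_le always_eventually allI) auto
  finally show ?thesis .
qed

end


subsection \<open>Truncation by multiples of a cutoff function\<close>

text \<open>
  A cutoff function together with the height \<open>c\<close> at which functions are truncated.  For a
  nonnegative \<open>f\<close> the function \<open>f \<and> c \<eta>\<close> has compact support and agrees with \<open>f\<close> where \<open>\<eta> = 1\<close> and
  \<open>f \<le> c\<close>.
\<close>
locale cutoff_function = intrinsic_metric_form m k D E J \<mu>c \<rho> mb mc
  for m k :: "'a::{metric_space, second_countable_topology} measure"
    and D :: "('a \<Rightarrow> real) set"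
    and E :: "('a \<Rightarrow> real) \<Rightarrow> ('a \<Rightarrow> real) \<Rightarrow> real"
    and J :: "('a \<times> 'a) measure"
    and \<mu>c :: "('a \<Rightarrow> real) \<Rightarrow> ('a \<Rightarrow> real) \<Rightarrow> 'a set \<Rightarrow> real"
    and \<rho> :: "'a \<Rightarrow> 'a \<Rightarrow> ennreal" and mb mc :: "'a measure" +
  fixes \<eta> :: "'a \<Rightarrow> real" and c :: real
  assumes eta_D: "\<eta> \<in> D" and eta_C_c: "\<eta> \<in> C_c" and eta_bounds: "\<forall>x. 0 \<le> \<eta> x \<and> \<eta> x \<le> 1"
    and c_nonneg: "0 \<le> c"
begin

definition S :: "'a set" where "S = closure {x. \<eta> x \<noteq> 0}"

definition clamp :: "('a \<Rightarrow> real) \<Rightarrow> 'a \<Rightarrow> real" where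
  "clamp f x = min (f x) (c * \<eta> x)"

text \<open>
  An additive set function that dominates the energy measures of \<open>f \<and> c \<eta>\<close> simultaneously for all \<open>f\<close>
  of interest: \<open>m\<^sub>c\<close> accounts for the region \<open>f < c \<eta>\<close> and \<open>c\<^sup>2 \<mu>\<^sup>c(\<eta>)\<close> for the rest.  Having one bound for
  all of them makes it stable under minima.
\<close>
definition bound :: "'a set \<Rightarrow> real" where
  "bound B = measure mc (B \<inter> S) + c\<^sup>2 * \<mu>c \<eta> \<eta> B"

lemma eta_continuous: "continuous_on UNIV \<eta>" and S_compact: "compact S"
  using eta_C_c by (simp_all add: C_c_def S_def)

lemma S_borel: "S \<in> sets borel"
  using S_compact by (intro borel_closed compact_imp_closed)

lemma eta_outside: "x \<notin> S \<Longrightarrow> \<eta> x = 0"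
  using closure_subset[of "{x. \<eta> x \<noteq> 0}"] by (auto simp: S_def)

lemma c_eta_D: "(\<lambda>x. c * \<eta> x) \<in> D"
  by (rule form.scale_closed[OF eta_D])

lemma c_eta_continuous: "continuous_on UNIV (\<lambda>x. c * \<eta> x)"
  using eta_continuous by (intro continuous_on_mult_left)

lemma mc_finite: "B \<in> sets borel \<Longrightarrow> emeasure mc (B \<inter> S) = ennreal (measure mc (B \<inter> S))"
proof -
  assume B: "B \<in> sets borel"
  have "emeasure mc S < \<infinity>"
    using admissible S_compact by (simp add: admissible_pair_def radon_measure_def)
  moreover have "emeasure mc (B \<inter> S) \<le> emeasure mc S"
    using S_borel sets_mc by (intro emeasure_mono) auto
  ultimately have "emeasure mc (B \<inter> S) \<noteq> \<infinity>" by (metis infinity_ennreal_def leD)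
  then show ?thesis by (simp add: emeasure_eq_ennreal_measure)
qed

lemma bound_split:
  assumes "A \<in> sets borel" "B \<in> sets borel"
  shows "bound (A \<inter> B) + bound (A - B) = bound A"
proof -
  have "A \<inter> S = (A \<inter> B \<inter> S) \<union> ((A - B) \<inter> S)" by blast
  then have "measure mc (A \<inter> S) = measure mc (A \<inter> B \<inter> S \<union> (A - B) \<inter> S)" by simp
  also have "\<dots> = measure mc (A \<inter> B \<inter> S) + measure mc ((A - B) \<inter> S)"
    using assms S_borel sets_mc mc_finite[of "A \<inter> B"] mc_finite[of "A - B"]
    by (intro measure_Union) auto
  finally show ?thesis
    using mu_split[OF eta_D assms] unfolding bound_def by (simp add: algebra_simps)
qed

text \<open>
  On \<open>{h < c \<eta>} \<subseteq> supp \<eta>\<close> the truncated function differs by a constant from a function in \<open>D\<close> that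
  represents \<open>\<rho>\<^sub>A \<and> T\<close>, and its energy measure is at most \<open>m\<^sub>c\<close>; elsewhere it equals \<open>c \<eta>\<close>.  For membership
  in \<open>D\<close> the constant \<open>a\<close> is replaced by \<open>a \<theta>\<close> with a cutoff function \<open>\<theta>\<close> that is \<open>1\<close> near \<open>supp \<eta>\<close>, and the representative \<open>v\<close> by \<open>\<bar>v\<bar>\<close>, so that
  the minimum with \<open>c \<eta>\<close> is \<open>0\<close> off \<open>supp \<eta>\<close>.
\<close>
lemma clamp_cut:
  fixes A :: "'a set"
  assumes T: "0 < T" and a: "0 \<le> a"
  defines "h \<equiv> \<lambda>x. a + pm_setdist_cut \<rho> A T x"
  shows "clamp h \<in> D" "B \<in> sets borel \<Longrightarrow> \<mu>c (clamp h) (clamp h) B \<le> bound B"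
proof -
  let ?r = "pm_setdist_cut \<rho> A T"
  have hc: "continuous_on UNIV h"
    unfolding h_def using cut_continuous[OF T] by (intro continuous_on_add continuous_on_const)
  have cc: "continuous_on UNIV (clamp h)"
    unfolding clamp_def[abs_def] using hc c_eta_continuous by (rule continuous_on_min)
  obtain G where G: "open G" "compact (closure G)" "S \<subseteq> G"
    using relatively_compact_neighbourhood[OF locally_compact S_compact] .
  obtain \<theta> where \<theta>: "\<theta> \<in> D" "\<theta> \<in> C_c" "\<forall>x. 0 \<le> \<theta> x \<and> \<theta> x \<le> 1" "\<forall>x\<in>closure G. \<theta> x = 1"
    by (rule cutoff[OF G(2)])
  have \<theta>1: "\<theta> x = 1" if "x \<in> G" for x using \<theta>(4) that closure_subset by blast
  have rD: "?r \<in> D_loc m D" using cut_D_loc_star[OF T] by (simp add: D_loc_star_def)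
  then obtain v where v: "v \<in> D" "AE x in m. x \<in> G \<longrightarrow> ?r x = v x"
    using G unfolding D_loc_def by blast
  have "(\<lambda>x. min (\<bar>v x\<bar> + a * \<theta> x) (c * \<eta> x)) \<in> D"
    by (intro D_min form.add_closed D_abs v(1) form.scale_closed \<theta>(1) eta_D)
  moreover have "AE x in m. min (\<bar>v x\<bar> + a * \<theta> x) (c * \<eta> x) = clamp h x"
    using v(2)
  proof eventually_elim
    case (elim x)
    show ?case
    proof (cases "x \<in> G")
      case True
      then have "v x = ?r x" using elim by simp
      then show ?thesis using \<theta>1[OF True] cut_nonneg[of A T x] by (simp add: clamp_def h_def)
    next
      case False
      then have "\<eta> x = 0" using G(3) eta_outside by blast
      moreover have "0 \<le> a * \<theta> x" using a \<theta>(3) by simp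
      ultimately show ?thesis using a cut_nonneg[of A T x] by (simp add: clamp_def h_def min_absorb2)
    qed
  qed
  ultimately show wD: "clamp h \<in> D"
    using D_cong[of _ "clamp h"] borel_measurable_continuous_onI[OF cc] by simp
  assume B: "B \<in> sets borel"
  define C where "C = {x. h x < c * \<eta> x}"
  have C: "open C" unfolding C_def using hc c_eta_continuous by (rule open_Collect_less)
  have CS: "C \<subseteq> S"
  proof
    fix x assume "x \<in> C"
    then have "0 < c * \<eta> x" using a cut_nonneg[of A T x] by (simp add: C_def h_def)
    then show "x \<in> S" using eta_outside by fastforce
  qed
  have CB: "C \<in> sets borel" using C by (rule borel_open)
  have "\<mu>c (clamp h) (clamp h) (B \<inter> C) \<le> measure mc (B \<inter> C \<inter> S)"
  proof -
    have BC: "B \<inter> C \<in> sets borel" using B CB by simp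
    have "\<mu>c (clamp h) (clamp h) (B \<inter> C) = \<mu>c (\<lambda>x. v x + a * \<theta> x) (\<lambda>x. v x + a * \<theta> x) (B \<inter> C)"
    proof (rule mu_open_local[OF wD form.add_closed[OF v(1) form.scale_closed[OF \<theta>(1)]] C _ BC])
      show "AE x in m. x \<in> C \<longrightarrow> clamp h x = v x + a * \<theta> x"
        using v(2)
      proof eventually_elim
        case (elim x)
        show ?case
        proof
          assume x: "x \<in> C"
          then have "x \<in> G" using CS G(3) by blast
          with elim \<theta>1 x show "clamp h x = v x + a * \<theta> x"
            by (simp add: clamp_def C_def h_def)
        qed
      qed
    qed simp
    also have "\<dots> = \<mu>c v v (B \<inter> C)"
      using CS G(3) \<theta>1 by (intro mu_add_cutoff[OF v(1) \<theta>(1,2) BC]) blast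
    finally have eq: "\<mu>c (clamp h) (clamp h) (B \<inter> C) = \<mu>c v v (B \<inter> C)" .
    have "ennreal (\<mu>c v v (B \<inter> C)) = emeasure (mu_c m D \<mu>c ?r) (B \<inter> C)"
      using CS G v BC by (intro extends_energyD[OF mu_c_extends[OF rD], symmetric]) auto
    also have "\<dots> \<le> emeasure mc (B \<inter> C)"
      using cut_bounded[OF T] BC unfolding energy_bounded_def by blast
    also have "\<dots> = ennreal (measure mc (B \<inter> C \<inter> S))"
    proof -
      have "B \<inter> C \<inter> S = B \<inter> C" using CS by blast
      then show ?thesis using mc_finite[OF BC] by simp
    qed
    finally show ?thesis unfolding eq by (simp add: ennreal_le_iff)
  qed
  moreover have "0 \<le> c\<^sup>2 * \<mu>c \<eta> \<eta> (B \<inter> C)" using mu_nonneg[OF eta_D, of "B \<inter> C"] B CB by simp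
  moreover have "\<mu>c (clamp h) (clamp h) (B - C) = c\<^sup>2 * \<mu>c \<eta> \<eta> (B - C)"
  proof -
    have BC: "B - C \<in> sets borel" using B CB by simp
    have "\<mu>c (clamp h) (clamp h) (B - C) = \<mu>c (\<lambda>x. c * \<eta> x) (\<lambda>x. c * \<eta> x) (B - C)"
      using wD c_eta_D cc c_eta_continuous BC by (intro mu_local) (auto simp: clamp_def C_def)
    then show ?thesis using psd_form.scale_diag[OF mu_psd_form[OF BC] eta_D] by simp
  qed
  ultimately have "\<mu>c (clamp h) (clamp h) B \<le> bound (B \<inter> C) + bound (B - C)"
    using mu_split[OF wD B CB] measure_nonneg[of mc "(B - C) \<inter> S"] unfolding bound_def by linarith
  then show "\<mu>c (clamp h) (clamp h) B \<le> bound B" using bound_split[OF B CB] by simp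
qed

lemma clamp_continuous: "continuous_on UNIV f \<Longrightarrow> continuous_on UNIV (clamp f)"
  unfolding clamp_def[abs_def] by (intro continuous_on_min c_eta_continuous)

lemma clamp_abs_le: "0 \<le> f x \<Longrightarrow> \<bar>clamp f x\<bar> \<le> c * \<eta> x"
  using eta_bounds c_nonneg by (auto simp: clamp_def min_def)

lemma clamp_L2:
  assumes "continuous_on UNIV f" "\<And>x. 0 \<le> f x"
  shows "clamp f \<in> L2 m"
proof -
  have int: "integrable m (\<lambda>x. (c * \<eta> x)\<^sup>2)" using D_L2[OF c_eta_D] by (simp add: L2_def)
  have meas: "clamp f \<in> borel_measurable borel"
    using clamp_continuous[OF assms(1)] by (rule borel_measurable_continuous_onI)
  have le: "(clamp f x)\<^sup>2 \<le> (c * \<eta> x)\<^sup>2" for x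
    using power_mono[OF clamp_abs_le[of f x], of 2] assms(2) by simp
  have "integrable m (\<lambda>x. (clamp f x)\<^sup>2)"
    by (rule Bochner_Integration.integrable_bound[OF int]) (use meas le in simp_all)
  then show ?thesis using meas by (simp add: L2_def)
qed

text \<open>
  All three parts of the energy of \<open>g \<and> c \<eta>\<close> are bounded independently of \<open>g\<close>: an increment of a minimum
  is at most an increment of \<open>g\<close> or of \<open>c \<eta>\<close>, and that of \<open>g\<close> matters only if one of the points is in
  \<open>supp \<eta>\<close>.
\<close>
lemma clamp_energy_bounded:
  obtains K where "\<forall>g. g \<in> Lip \<longrightarrow> (\<forall>x. 0 \<le> g x) \<longrightarrow> clamp g \<in> D \<longrightarrow>
    (\<forall>B\<in>sets borel. \<mu>c (clamp g) (clamp g) B \<le> bound B) \<longrightarrow> E1 m E (clamp g) \<le> K"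
proof -
  let ?e = "ennreal (c\<^sup>2) * ennreal (E \<eta> \<eta>)"
  define K where "K = 2 * emeasure mb S + ?e + ennreal (bound UNIV) + ?e"
  have "emeasure mb S < \<infinity>"
    using admissible S_compact by (simp add: admissible_pair_def radon_measure_def)
  then have K: "K < top" unfolding K_def by (simp add: ennreal_mult_less_top)
  have "E1 m E (clamp g) \<le> enn2real K + (\<integral>x. (c * \<eta> x)\<^sup>2 \<partial>m)"
    if g: "g \<in> Lip" and pos: "\<forall>x. 0 \<le> g x" and gD: "clamp g \<in> D"
      and gB: "\<forall>B\<in>sets borel. \<mu>c (clamp g) (clamp g) B \<le> bound B" for g
  proof -
    note gc = Lip_continuous[OF g]
    have e: "(\<integral>\<^sup>+p. increment \<eta> p * indicator (- diag) p \<partial>J) \<le> ennreal (E \<eta> \<eta>)"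
      "(\<integral>\<^sup>+x. ennreal ((\<eta> x)\<^sup>2) \<partial>k) \<le> ennreal (E \<eta> \<eta>)"
      unfolding energy_continuous[OF eta_D eta_continuous] by (simp_all add: add_increasing add_increasing2)
    have "(\<integral>\<^sup>+p. increment (clamp g) p * indicator (- diag) p \<partial>J)
        \<le> 2 * mu_b m D E J g S + ennreal (c\<^sup>2) * (\<integral>\<^sup>+p. increment \<eta> p * indicator (- diag) p \<partial>J)"
    proof (rule jump_energy_le[OF clamp_continuous[OF gc] gc eta_continuous S_borel])
      fix x y
      show "(clamp g x - clamp g y)\<^sup>2
          \<le> (if x \<in> S \<or> y \<in> S then (g x - g y)\<^sup>2 else 0) + c\<^sup>2 * (\<eta> x - \<eta> y)\<^sup>2"
      proof (cases "x \<in> S \<or> y \<in> S")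
        case True
        have "(clamp g x - clamp g y)\<^sup>2 \<le> (g x - g y)\<^sup>2 + (c * \<eta> x - c * \<eta> y)\<^sup>2"
          unfolding clamp_def by (rule square_min_diff_le)
        then show ?thesis using True by (simp add: power_mult_distrib flip: right_diff_distrib)
      next
        case False
        then show ?thesis using eta_outside pos by (simp add: clamp_def min_absorb2)
      qed
    qed simp
    also have "\<dots> \<le> 2 * emeasure mb S + ?e"
      using Lip_mu_b_le[OF g S_borel] e(1) by (intro add_mono mult_left_mono) auto
    finally have jump: "(\<integral>\<^sup>+p. increment (clamp g) p * indicator (- diag) p \<partial>J) \<le> 2 * emeasure mb S + ?e" .
    have "(\<integral>\<^sup>+x. ennreal ((clamp g x)\<^sup>2) \<partial>k) \<le> (\<integral>\<^sup>+x. ennreal (c\<^sup>2) * ennreal ((\<eta> x)\<^sup>2) \<partial>k)"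
    proof (rule nn_integral_mono)
      fix x
      have "(clamp g x)\<^sup>2 \<le> (c * \<eta> x)\<^sup>2"
        using power_mono[OF clamp_abs_le[of g x], of 2] pos by simp
      then show "ennreal ((clamp g x)\<^sup>2) \<le> ennreal (c\<^sup>2) * ennreal ((\<eta> x)\<^sup>2)"
        by (simp add: power_mult_distrib ennreal_leI flip: ennreal_mult)
    qed
    also have "\<dots> = ennreal (c\<^sup>2) * (\<integral>\<^sup>+x. ennreal ((\<eta> x)\<^sup>2) \<partial>k)"
    proof (rule nn_integral_cmult)
      have "sets k = sets borel" using decomposition by (simp add: beurling_deny_def radon_measure_def)
      then have "borel_measurable k = (borel_measurable borel :: ('a \<Rightarrow> ennreal) set)"
        by (rule measurable_cong_sets) simp
      then show "(\<lambda>x. ennreal ((\<eta> x)\<^sup>2)) \<in> borel_measurable k"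
        using D_measurable[OF eta_D] by simp
    qed
    also have "\<dots> \<le> ?e" using e(2) by (intro mult_left_mono) auto
    finally have kill: "(\<integral>\<^sup>+x. ennreal ((clamp g x)\<^sup>2) \<partial>k) \<le> ?e" .
    have "ennreal (E (clamp g) (clamp g)) \<le> K"
      unfolding energy_continuous[OF gD clamp_continuous[OF gc]] K_def
      using jump kill gB by (intro add_mono ennreal_leI) auto
    then have "E (clamp g) (clamp g) \<le> enn2real K"
      using K form.nonneg[OF gD] by (metis enn2real_ennreal enn2real_mono)
    moreover have "(\<integral>x. (clamp g x)\<^sup>2 \<partial>m) \<le> (\<integral>x. (c * \<eta> x)\<^sup>2 \<partial>m)"
    proof (rule integral_mono)
      show "integrable m (\<lambda>x. (clamp g x)\<^sup>2)" "integrable m (\<lambda>x. (c * \<eta> x)\<^sup>2)"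
        using D_L2[OF gD] D_L2[OF c_eta_D] by (simp_all add: L2_def)
      show "(clamp g x)\<^sup>2 \<le> (c * \<eta> x)\<^sup>2" for x
        using power_mono[OF clamp_abs_le[of g x], of 2] pos by simp
    qed
    ultimately show ?thesis by (simp add: E1_def)
  qed
  then show ?thesis by (intro that) blast
qed

text \<open>
  For \<open>0 \<le> f \<le> T\<close> the Lipschitz condition gives \<open>f \<le> h\<^sub>i\<close> with \<open>h\<^sub>i = f(y\<^sub>i) + \<rho>(\<cdot>, y\<^sub>i) \<and> T\<close>, with almost
  equality at points close to \<open>y\<^sub>i\<close>.  Hence the running minima \<open>g\<^sub>n\<close> of the \<open>h\<^sub>i\<close> decrease to \<open>f\<close>.  They
  are again Lipschitz, so the truncations \<open>g\<^sub>n \<and> c \<eta>\<close> have bounded energies, and they converge to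
  \<open>f \<and> c \<eta>\<close> in \<open>L\<^sup>2\<close>.
\<close>
lemma clamp_Lip:
  assumes f: "f \<in> Lip" "\<And>x. 0 \<le> f x" "\<And>x. f x \<le> T" and T: "0 < T"
  shows "clamp f \<in> D" "B \<in> sets borel \<Longrightarrow> \<mu>c (clamp f) (clamp f) B \<le> bound B"
proof -
  obtain y :: "nat \<Rightarrow> 'a" where y: "\<forall>U. open U \<longrightarrow> U \<noteq> {} \<longrightarrow> (\<exists>i. y i \<in> U)"
    using dense_sequence .
  define h where "h i x = f (y i) + pm_setdist_cut \<rho> {y i} T x" for i x
  define g where "g = rec_nat (h 0) (\<lambda>n g x. min (g x) (h (Suc n) x))"
  have g0: "g 0 = h 0" and gSuc: "g (Suc n) = (\<lambda>x. min (g n x) (h (Suc n) x))" for n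
    by (simp_all add: g_def)
  have h_ge: "f x \<le> h i x" for i x
  proof -
    have "ennreal (f x - f (y i)) \<le> min (\<rho> x (y i)) (ennreal T)"
    proof (rule min.boundedI)
      show "ennreal (f x - f (y i)) \<le> \<rho> x (y i)"
        using f(1) by (auto intro: order_trans[OF ennreal_leI[OF abs_ge_self]])
      show "ennreal (f x - f (y i)) \<le> ennreal T" using f(2)[of "y i"] f(3)[of x] by (intro ennreal_leI) simp
    qed
    then have "ennreal (f x - f (y i)) \<le> ennreal (pm_setdist_cut \<rho> {y i} T x)"
      by (simp add: ennreal_cut_point)
    then show ?thesis using cut_nonneg by (simp add: h_def ennreal_le_iff)
  qed
  have h_Lip: "h i \<in> Lip" for i using cut_point_Lip[of "y i" T] by (simp add: h_def)
  have h_D: "clamp (h i) \<in> D" "B \<in> sets borel \<Longrightarrow> \<mu>c (clamp (h i)) (clamp (h i)) B \<le> bound B" for i B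
    unfolding h_def[abs_def] using clamp_cut[OF T f(2)] by simp_all
  have g_ge: "f x \<le> g n x" for n x by (induction n) (simp_all add: g0 gSuc h_ge)
  have g_le: "g n x \<le> h i x" if "i \<le> n" for n i x
    using that
  proof (induction n)
    case (Suc n)
    then show ?case by (cases "i = Suc n") (simp_all add: gSuc min.coboundedI1)
  qed (simp add: g0)
  have g_Lip: "g n \<in> Lip" for n
  proof (induction n)
    case (Suc n)
    have "\<bar>min a b - min a' b'\<bar> \<le> \<bar>a - a'\<bar> \<or> \<bar>min a b - min a' b'\<bar> \<le> \<bar>b - b'\<bar>" for a b a' b' :: real
      by (simp add: min_def abs_if)
    then have "ennreal \<bar>g (Suc n) x - g (Suc n) z\<bar> \<le> \<rho> x z" for x z
      using Suc h_Lip[of "Suc n"] unfolding gSuc mem_Collect_eq by (meson ennreal_leI order_trans)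
    then show ?case by simp
  qed (simp only: g0 h_Lip)
  have g_D: "clamp (g n) \<in> D \<and> (\<forall>B\<in>sets borel. \<mu>c (clamp (g n)) (clamp (g n)) B \<le> bound B)" for n
  proof (induction n)
    case (Suc n)
    have eq: "clamp (g (Suc n)) = (\<lambda>x. min (clamp (g n) x) (clamp (h (Suc n)) x))"
      by (auto simp: clamp_def gSuc)
    have "continuous_on UNIV (clamp (g n))" "continuous_on UNIV (clamp (h (Suc n)))"
      using Lip_continuous g_Lip h_Lip by (intro clamp_continuous; blast)+
    with Suc h_D(1)[of "Suc n"] h_D(2)[of _ "Suc n"] show ?case
      unfolding eq by (auto intro: D_min mu_min_le bound_split)
  qed (simp add: g0 h_D)
  obtain K where K: "\<forall>g. g \<in> Lip \<longrightarrow> (\<forall>x. 0 \<le> g x) \<longrightarrow> clamp g \<in> D \<longrightarrow>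
    (\<forall>B\<in>sets borel. \<mu>c (clamp g) (clamp g) B \<le> bound B) \<longrightarrow> E1 m E (clamp g) \<le> K"
    by (rule clamp_energy_bounded)
  have pos: "0 \<le> g n x" for n x using f(2) g_ge order_trans by blast
  have gK: "E1 m E (clamp (g n)) \<le> K" for n
    using K[rule_format, of "g n"] g_Lip g_D pos by simp
  have g_lim: "(\<lambda>n. g n x) \<longlonglongrightarrow> f x" for x
  proof (rule LIMSEQ_I)
    fix e :: real assume e: "0 < e"
    have "{z. \<rho> z x < ennreal (e / 2)} \<noteq> {}" using e by (auto intro: exI[of _ x])
    then obtain i where i: "\<rho> (y i) x < ennreal (e / 2)" using y open_rho_ball[of "e / 2" x] e by auto
    have "ennreal \<bar>f (y i) - f x\<bar> < ennreal (e / 2)" using f(1) i by (auto intro: le_less_trans)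
    then have 1: "\<bar>f (y i) - f x\<bar> < e / 2" by (simp add: ennreal_less_iff)
    have "ennreal (pm_setdist_cut \<rho> {y i} T x) < ennreal (e / 2)"
      unfolding ennreal_cut_point using i rho_sym[of x "y i"] by (simp add: min_less_iff_disj)
    then have 2: "pm_setdist_cut \<rho> {y i} T x < e / 2" using cut_nonneg by (simp add: ennreal_less_iff)
    have "norm (g n x - f x) < e" if "i \<le> n" for n
      using g_le[OF that, of x] g_ge[of x n] 1 2 unfolding h_def real_norm_def by linarith
    then show "\<exists>N. \<forall>n\<ge>N. norm (g n x - f x) < e" by blast
  qed
  note fc = Lip_continuous[OF f(1)]
  have wL: "clamp f \<in> L2 m" by (rule clamp_L2[OF fc f(2)])
  have "(\<lambda>n. \<integral>x. (clamp (g n) x - clamp f x)\<^sup>2 \<partial>m) \<longlonglongrightarrow> (\<integral>x. 0 \<partial>m)"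
  proof (rule integral_dominated_convergence[where w="\<lambda>x. (c * \<eta> x)\<^sup>2"])
    show "integrable m (\<lambda>x. (c * \<eta> x)\<^sup>2)" using D_L2[OF c_eta_D] by (simp add: L2_def)
    show "AE x in m. (\<lambda>n. (clamp (g n) x - clamp f x)\<^sup>2) \<longlonglongrightarrow> 0"
    proof (rule AE_I2)
      fix x
      have "(\<lambda>n. (clamp (g n) x - clamp f x)\<^sup>2) \<longlonglongrightarrow> (clamp f x - clamp f x)\<^sup>2"
        unfolding clamp_def by (intro tendsto_power tendsto_diff tendsto_min g_lim tendsto_const)
      then show "(\<lambda>n. (clamp (g n) x - clamp f x)\<^sup>2) \<longlonglongrightarrow> 0" by simp
    qed
    show "AE x in m. norm ((clamp (g n) x - clamp f x)\<^sup>2) \<le> (c * \<eta> x)\<^sup>2" for n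
    proof (rule AE_I2)
      fix x
      have "0 \<le> clamp f x" "clamp f x \<le> clamp (g n) x" "clamp (g n) x \<le> c * \<eta> x"
        using f(2)[of x] g_ge[of x n] eta_bounds c_nonneg by (auto simp: clamp_def)
      then have "(clamp (g n) x - clamp f x)\<^sup>2 \<le> (c * \<eta> x)\<^sup>2" by (intro power_mono) auto
      then show "norm ((clamp (g n) x - clamp f x)\<^sup>2) \<le> (c * \<eta> x)\<^sup>2" by simp
    qed
  qed (use wL D_measurable g_D in \<open>auto simp: L2_def\<close>)
  then have lim: "(\<lambda>n. \<integral>x. (clamp (g n) x - clamp f x)\<^sup>2 \<partial>m) \<longlonglongrightarrow> 0" by simp
  note lsc = energy_lower_semicontinuous[of "\<lambda>n. clamp (g n)" K, OF _ gK wL lim]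
  show "clamp f \<in> D" using lsc(1)[of UNIV "bound UNIV"] g_D by simp
  show "\<mu>c (clamp f) (clamp f) B \<le> bound B" if "B \<in> sets borel"
    using lsc(2)[OF _ that, of "bound B"] g_D that by simp
qed

end


context intrinsic_metric_form
begin

subsection \<open>Lipschitz functions are intrinsic-metric functions\<close>

text \<open>
  On \<open>G\<close> the function is bounded by some \<open>a\<close> and can be replaced by the clipped and shifted function
  \<open>g\<close> with values in \<open>[0, 2a]\<close>.  With \<open>\<eta> = 1\<close> on \<open>G\<close> and truncation height \<open>2a\<close>, truncating does not change
  \<open>g\<close> on \<open>G\<close>, and subtracting \<open>a \<eta>\<close> undoes the shift there.
\<close>
lemma Lip_locally_in_D:
  assumes f: "f \<in> Lip" and G: "open G" "compact (closure G)"
  shows "\<exists>v\<in>D. (AE x in m. x \<in> G \<longrightarrow> f x = v x) \<and>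
    (\<forall>B\<in>sets borel. B \<subseteq> G \<longrightarrow> ennreal (\<mu>c v v B) \<le> emeasure mc B)"
proof -
  obtain \<eta> where \<eta>: "\<eta> \<in> D" "\<eta> \<in> C_c" "\<forall>x. 0 \<le> \<eta> x \<and> \<eta> x \<le> 1" "\<forall>x\<in>closure G. \<eta> x = 1"
    by (rule cutoff[OF G(2)])
  have \<eta>1: "\<eta> x = 1" if "x \<in> G" for x using \<eta>(4) that closure_subset by blast
  have "compact (f ` closure G)"
    using continuous_on_subset[OF Lip_continuous[OF f] subset_UNIV] G(2) by (rule compact_continuous_image)
  then obtain a where a: "0 < a" "\<forall>y\<in>f ` closure G. norm y \<le> a"
    using compact_imp_bounded bounded_pos by metis
  have fa: "\<bar>f x\<bar> \<le> a" if "x \<in> G" for x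
    using a(2) that closure_subset[of G] by auto
  define g where "g x = max (- a) (min (f x) a) + a" for x
  have g: "0 \<le> g x" "g x \<le> 2 * a" for x using a(1) by (auto simp: g_def)
  have gL: "g \<in> Lip"
  proof (clarify)
    fix x z
    have "\<bar>g x - g z\<bar> \<le> \<bar>f x - f z\<bar>" by (simp add: g_def min_def max_def abs_if)
    then have "ennreal \<bar>g x - g z\<bar> \<le> ennreal \<bar>f x - f z\<bar>" by (rule ennreal_leI)
    also have "\<dots> \<le> \<rho> x z" using f by simp
    finally show "ennreal \<bar>g x - g z\<bar> \<le> \<rho> x z" .
  qed
  interpret \<eta>: cutoff_function m k D E J \<mu>c \<rho> mb mc \<eta> "2 * a"
    using \<eta> a(1) by unfold_locales auto
  have wD: "\<eta>.clamp g \<in> D" using a(1) by (intro \<eta>.clamp_Lip(1)[OF gL g]) simp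
  have wG: "\<eta>.clamp g x = f x + a" if "x \<in> G" for x
    using \<eta>1[OF that] fa[OF that] g(2)[of x] by (auto simp: \<eta>.clamp_def g_def)
  show ?thesis
  proof (intro bexI conjI ballI impI)
    show "(\<lambda>x. \<eta>.clamp g x + (- a) * \<eta> x) \<in> D" by (intro form.add_closed form.scale_closed wD \<eta>(1))
    show "AE x in m. x \<in> G \<longrightarrow> f x = \<eta>.clamp g x + (- a) * \<eta> x"
      using wG \<eta>1 by (intro AE_I2) simp
    fix B :: "'a set" assume B: "B \<in> sets borel" "B \<subseteq> G"
    have one: "\<eta> x = 1" if "x \<in> B" for x using B(2) that \<eta>1 by blast
    have "\<mu>c (\<lambda>x. \<eta>.clamp g x + (- a) * \<eta> x) (\<lambda>x. \<eta>.clamp g x + (- a) * \<eta> x) B = \<mu>c (\<eta>.clamp g) (\<eta>.clamp g) B"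
      by (rule mu_add_cutoff[OF wD \<eta>(1,2) B(1) one])
    also have "\<dots> \<le> \<eta>.bound B" using a(1) by (intro \<eta>.clamp_Lip(2)[OF gL g _ B(1)]) simp
    also have "\<dots> = measure mc (B \<inter> \<eta>.S)"
      using mu_cutoff_null[OF \<eta>(1,2) B(1) one] by (simp add: \<eta>.bound_def)
    finally have "ennreal (\<mu>c (\<lambda>x. \<eta>.clamp g x + (- a) * \<eta> x) (\<lambda>x. \<eta>.clamp g x + (- a) * \<eta> x) B)
        \<le> emeasure mc (B \<inter> \<eta>.S)"
      unfolding \<eta>.mc_finite[OF B(1)] by (rule ennreal_leI)
    also have "\<dots> \<le> emeasure mc B" using B(1) sets_mc by (intro emeasure_mono) auto
    finally show "ennreal (\<mu>c (\<lambda>x. \<eta>.clamp g x + (- a) * \<eta> x) (\<lambda>x. \<eta>.clamp g x + (- a) * \<eta> x) B)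
        \<le> emeasure mc B" .
  qed
qed

lemma Lip_D_loc_star:
  assumes f: "f \<in> Lip"
  shows "f \<in> D_loc_star m D E J"
proof -
  have "\<exists>v\<in>D. AE x in m. x \<in> G \<longrightarrow> f x = v x" if "open G" "compact (closure G)" for G
    using Lip_locally_in_D[OF f that] by (elim bexE conjE) (rule bexI)
  then have "f \<in> D_loc m D"
    using continuous_L2_loc[OF Lip_continuous[OF f]] by (simp add: D_loc_def)
  moreover have "mu_b m D E J f K < \<infinity>" if "compact K" for K
  proof -
    have "mu_b m D E J f K \<le> emeasure mb K"
      using that by (intro Lip_mu_b_le[OF f] borel_closed compact_imp_closed)
    also have "\<dots> < \<infinity>" using admissible that by (simp add: admissible_pair_def radon_measure_def)
    finally show ?thesis .
  qed
  ultimately show ?thesis by (simp add: D_loc_star_def)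
qed

lemma Lip_energy_bounded:
  assumes f: "f \<in> Lip"
  shows "energy_bounded m D E J \<mu>c mb mc f"
proof -
  have "f \<in> D_loc m D" using Lip_D_loc_star[OF f] by (simp add: D_loc_star_def)
  then show ?thesis
    unfolding energy_bounded_def
    by (intro conjI ballI Lip_mu_b_le[OF f] mu_c_le_if_locally_le[OF _ sets_mc] Lip_locally_in_D[OF f])
qed

lemma Lip_SUP:
  assumes f: "\<And>i::nat. f i \<in> Lip" and bdd: "\<And>x. bdd_above (range (\<lambda>i. f i x))"
  shows "(\<lambda>x. SUP i. f i x) \<in> Lip"
proof (intro CollectI allI)
  fix x z
  show "ennreal \<bar>(SUP i. f i x) - (SUP i. f i z)\<bar> \<le> \<rho> x z"
  proof (cases "\<rho> x z")
    case (real r)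
    have *: "(SUP i. f i x') \<le> (SUP i. f i z') + r" if "\<rho> x' z' = ennreal r" for x' z'
    proof (rule cSUP_least)
      fix i
      have "\<forall>x z. ennreal \<bar>f i x - f i z\<bar> \<le> \<rho> x z" using f[of i] by simp
      then have "ennreal \<bar>f i x' - f i z'\<bar> \<le> ennreal r" unfolding that[symmetric] by (elim allE)
      then have "f i x' \<le> f i z' + r" using real(1) by (simp add: ennreal_le_iff abs_le_iff)
      also have "\<dots> \<le> (SUP i. f i z') + r" using bdd by (intro add_right_mono cSUP_upper) auto
      finally show "f i x' \<le> (SUP i. f i z') + r" .
    qed simp
    have "\<rho> z x = ennreal r" using real rho_sym[of x z] by simp
    with *[of x z] *[of z x] real show ?thesis unfolding real(2) by (intro ennreal_leI) linarith
  qed simp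
qed

lemma Lip_intrinsic_metric_functions: "intrinsic_metric_functions m D E J \<mu>c Lip"
  unfolding intrinsic_metric_functions_def
proof (intro conjI allI impI ballI)
  show "Lip \<subseteq> D_loc_star m D E J \<inter> {f. continuous_on UNIV f}"
    using Lip_D_loc_star Lip_continuous by blast
  show "\<exists>mb mc. admissible_pair m mb mc \<and> (\<forall>f\<in>Lip. energy_bounded m D E J \<mu>c mb mc f)"
    using admissible Lip_energy_bounded by blast
  show "(\<lambda>x. SUP i. f i x) \<in> Lip"
    if "\<forall>i::nat. f i \<in> Lip" "\<forall>x. bdd_above (range (\<lambda>i. f i x))" for f
    using that by (intro Lip_SUP) simp_all
qed (auto simp: abs_minus_commute)

text \<open>
  The Lipschitz functions \<open>\<rho>(\<cdot>, y) \<and> T\<close> vanish at \<open>y\<close>, and their values at \<open>x\<close> tend to \<open>\<rho> x y\<close>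
  as \<open>T \<rightarrow> \<infinity>\<close>.
\<close>
lemma metric_of_Lip: "metric_of Lip = \<rho>"
proof (intro ext antisym)
  fix x y
  show "metric_of Lip x y \<le> \<rho> x y"
    unfolding metric_of_def
  proof (rule SUP_least)
    fix f assume "f \<in> {f \<in> Lip. f y = 0}"
    then have f: "\<forall>x y. ennreal \<bar>f x - f y\<bar> \<le> \<rho> x y" "f y = 0" by auto
    have "ennreal (f x) \<le> ennreal \<bar>f x - f y\<bar>" using f(2) by (intro ennreal_leI) simp
    also have "\<dots> \<le> \<rho> x y" using f(1) by (elim allE)
    finally show "ennreal (f x) \<le> \<rho> x y" .
  qed
  have le: "min (\<rho> x y) (ennreal T) \<le> metric_of Lip x y" if "0 < T" for T
  proof -
    have "ennreal (pm_setdist_cut \<rho> {y} T y) = 0" by (simp add: ennreal_cut_point)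
    then have "pm_setdist_cut \<rho> {y} T y = 0" using cut_nonneg[of "{y}" T y] by simp
    then have "ennreal (pm_setdist_cut \<rho> {y} T x) \<le> metric_of Lip x y"
      unfolding metric_of_def using cut_point_Lip[of y T] by (intro SUP_upper) simp
    then show ?thesis by (simp add: ennreal_cut_point)
  qed
  show "\<rho> x y \<le> metric_of Lip x y"
  proof (cases "metric_of Lip x y")
    case (real t)
    then have "min (\<rho> x y) (ennreal (t + 1)) \<le> ennreal t" using le[of "t + 1"] by simp
    moreover have "\<not> ennreal (t + 1) \<le> ennreal t" using real(1) by (simp add: ennreal_le_iff)
    ultimately show ?thesis unfolding real by (simp add: min_le_iff_disj)
  qed simp
qed

end


section \<open>Metrics of sets of intrinsic-metric functions\<close>

text \<open>
  For every rational \<open>q\<close>, the open cover of \<open>{sup F > q}\<close> by the sets \<open>{f > q}\<close> has a countable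
  subcover.  The members of \<open>F\<close> selected for all \<open>q\<close> form the countable subfamily.
\<close>
lemma countable_subfamily_same_supremum:
  fixes F :: "('a::second_countable_topology \<Rightarrow> real) set"
  assumes F: "F \<noteq> {}" and cont: "\<And>f. f \<in> F \<Longrightarrow> continuous_on UNIV f"
    and bdd: "\<And>x. bdd_above ((\<lambda>f. f x) ` F)"
  obtains g :: "nat \<Rightarrow> 'a \<Rightarrow> real" where "range g \<subseteq> F" "(\<lambda>x. SUP i. g i x) = (\<lambda>x. SUP f\<in>F. f x)"
proof -
  have "\<exists>F'\<subseteq>F. countable F' \<and> (\<Union>f\<in>F'. {x. q < f x}) = (\<Union>f\<in>F. {x. q < f x})" for q :: real
  proof -
    have "open U" if "U \<in> (\<lambda>f. {x. q < f x}) ` F" for U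
      using that cont by (auto intro: open_Collect_less continuous_on_const)
    then obtain \<U> where \<U>: "\<U> \<subseteq> (\<lambda>f. {x. q < f x}) ` F" "countable \<U>"
        "\<Union>\<U> = \<Union>((\<lambda>f. {x. q < f x}) ` F)"
      by (rule Lindelof)
    obtain F' where F': "F' \<subseteq> F" "countable F'" "\<U> = (\<lambda>f. {x. q < f x}) ` F'"
      using countable_subset_image[THEN iffD1, OF conjI[OF \<U>(2,1)]] by auto
    then show ?thesis using \<U>(3) by (intro exI[of _ F']) simp
  qed
  then have "\<forall>q. \<exists>F'. F' \<subseteq> F \<and> countable F' \<and> (\<Union>f\<in>F'. {x. q < f x}) = (\<Union>f\<in>F. {x. q < f x})" by simp
  then obtain F' where F': "\<forall>q. F' q \<subseteq> F \<and> countable (F' q) \<and>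
      (\<Union>f\<in>F' q. {x. q < f x}) = (\<Union>f\<in>F. {x. q < f x})"
    by (elim choice[THEN exE])
  obtain f0 where f0: "f0 \<in> F" using F by blast
  define H where "H = insert f0 (\<Union>q\<in>\<rat>. F' q)"
  have F'F: "F' q \<subseteq> F" and F'c: "countable (F' q)"
    and F'U: "(\<Union>f\<in>F' q. {x. q < f x}) = (\<Union>f\<in>F. {x. q < f x})" for q
    using spec[OF F', of q] by simp_all
  have "countable H" unfolding H_def by (intro countable_insert countable_UN countable_rat F'c)
  then have g: "range (from_nat_into H) = H" by (intro range_from_nat_into) (simp add: H_def)
  have HF: "H \<subseteq> F"
  proof
    fix f assume "f \<in> H"
    then consider "f = f0" | q where "f \<in> F' q" unfolding H_def by blast
    then show "f \<in> F" using f0 subsetD[OF F'F] by cases simp_all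
  qed
  have "(SUP i. from_nat_into H i x) = (SUP f\<in>F. f x)" for x
  proof -
    have "(SUP i. from_nat_into H i x) = (SUP f\<in>H. f x)"
      using arg_cong[OF g, of "image (\<lambda>f. f x)"] by (simp add: image_image)
    also have "\<dots> = (SUP f\<in>F. f x)"
    proof (rule antisym)
      show "(SUP f\<in>H. f x) \<le> (SUP f\<in>F. f x)"
        using HF bdd by (intro cSUP_subset_mono) (auto simp: H_def)
      show "(SUP f\<in>F. f x) \<le> (SUP f\<in>H. f x)"
      proof (rule ccontr)
        assume "\<not> ?thesis"
        then obtain q where q: "q \<in> \<rat>" "(SUP f\<in>H. f x) < q" "q < (SUP f\<in>F. f x)"
          using Rats_dense_in_real by (meson not_le)
        then obtain f where "f \<in> F" "q < f x" using less_cSUP_iff[OF F bdd] by blast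
        then have "x \<in> (\<Union>f\<in>F. {x. q < f x})" by blast
        then have "x \<in> (\<Union>f\<in>F' q. {x. q < f x})" unfolding F'U .
        then obtain f' where f': "f' \<in> H" "q < f' x" using q(1) unfolding H_def by blast
        have "bdd_above ((\<lambda>f. f x) ` H)" using bdd HF by (rule bdd_above_mono[OF _ image_mono])
        then have "f' x \<le> (SUP f\<in>H. f x)" using f'(1) by (intro cSUP_upper)
        with f'(2) q(2) show False by simp
      qed
    qed
    finally show ?thesis .
  qed
  then show ?thesis using g HF by (intro that[of "from_nat_into H"]) auto
qed

locale intrinsic_functions =
  fixes m :: "'a::{metric_space, second_countable_topology} measure"
    and D :: "('a \<Rightarrow> real) set"
    and E :: "('a \<Rightarrow> real) \<Rightarrow> ('a \<Rightarrow> real) \<Rightarrow> real"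
    and J :: "('a \<times> 'a) measure"
    and \<mu>c :: "('a \<Rightarrow> real) \<Rightarrow> ('a \<Rightarrow> real) \<Rightarrow> 'a set \<Rightarrow> real"
    and M :: "('a \<Rightarrow> real) set"
  assumes function_axioms: "intrinsic_metric_functions m D E J \<mu>c M"
begin

lemma M_subset: "M \<subseteq> D_loc_star m D E J \<inter> {f. continuous_on UNIV f}"
  using function_axioms unfolding intrinsic_metric_functions_def by (elim conjE)

lemma M_D_loc_star: "f \<in> M \<Longrightarrow> f \<in> D_loc_star m D E J"
  using M_subset by blast

lemma M_continuous: "f \<in> M \<Longrightarrow> continuous_on UNIV f"
  using M_subset by blast

lemma M_zero: "(\<lambda>x. 0) \<in> M"
  using function_axioms unfolding intrinsic_metric_functions_def by (elim conjE)

lemma M_add: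
  assumes "f \<in> M"
  shows "(\<lambda>x. f x + c) \<in> M"
proof -
  have "\<forall>c. \<forall>f\<in>M. (\<lambda>x. f x + c) \<in> M"
    using function_axioms unfolding intrinsic_metric_functions_def by (elim conjE)
  from bspec[OF spec[OF this] assms] show ?thesis .
qed

lemma M_minus:
  assumes "f \<in> M"
  shows "(\<lambda>x. - f x) \<in> M"
proof -
  have "\<forall>f\<in>M. (\<lambda>x. - f x) \<in> M"
    using function_axioms unfolding intrinsic_metric_functions_def by (elim conjE)
  from bspec[OF this assms] show ?thesis .
qed

lemma M_countable_SUP:
  assumes "\<forall>i::nat. f i \<in> M" "\<forall>x. bdd_above (range (\<lambda>i. f i x))"
  shows "(\<lambda>x. SUP i. f i x) \<in> M"
proof -
  have "\<forall>f. (\<forall>i::nat. f i \<in> M) \<longrightarrow> (\<forall>x. bdd_above (range (\<lambda>i. f i x))) \<longrightarrow> (\<lambda>x. SUP i. f i x) \<in> M"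
    using function_axioms unfolding intrinsic_metric_functions_def by (elim conjE)
  from mp[OF mp[OF spec[OF this] assms(1)] assms(2)] show ?thesis .
qed

lemma M_SUP:
  assumes F: "F \<noteq> {}" "F \<subseteq> M" and bdd: "\<And>x. bdd_above ((\<lambda>f. f x) ` F)"
  shows "(\<lambda>x. SUP f\<in>F. f x) \<in> M"
proof -
  have cont: "continuous_on UNIV f" if "f \<in> F" for f using that F(2) M_continuous by blast
  obtain g :: "nat \<Rightarrow> 'a \<Rightarrow> real" where g: "range g \<subseteq> F" "(\<lambda>x. SUP i. g i x) = (\<lambda>x. SUP f\<in>F. f x)"
    by (rule countable_subfamily_same_supremum[OF F(1) cont bdd])
  have "bdd_above (range (\<lambda>i. g i x))" for x
    using g(1) by (intro bdd_above_mono[OF bdd[of x]]) auto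
  then have "(\<lambda>x. SUP i. g i x) \<in> M" using g(1) F(2) by (intro M_countable_SUP) auto
  then show ?thesis using g(2) by simp
qed

lemma M_INF:
  assumes F: "F \<noteq> {}" "F \<subseteq> M" and bdd: "\<And>x. bdd_below ((\<lambda>f. f x) ` F)"
  shows "(\<lambda>x. INF f\<in>F. f x) \<in> M"
proof -
  have "(\<lambda>x. SUP f\<in>(\<lambda>f x. - f x) ` F. f x) \<in> M"
  proof (rule M_SUP)
    show "(\<lambda>f x. - f x) ` F \<subseteq> M" using F(2) M_minus by auto
    show "bdd_above ((\<lambda>f. f x) ` (\<lambda>f x. - f x) ` F)" for x
      using bdd[of x] by (simp add: image_image bdd_above_uminus_image)
  qed (use F(1) in simp)
  then have "(\<lambda>x. - (SUP f\<in>(\<lambda>f x. - f x) ` F. f x)) \<in> M" by (rule M_minus)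
  moreover have "- (SUP f\<in>(\<lambda>f x. - f x) ` F. f x) = (INF f\<in>F. f x)" for x
    by (simp add: Inf_real_def image_image)
  ultimately show ?thesis by simp
qed

lemma M_const: "(\<lambda>x. c) \<in> M"
  using M_add[OF M_zero, of c] by simp

lemma M_min_const:
  assumes "f \<in> M"
  shows "(\<lambda>x. min (f x) c) \<in> M"
proof -
  have "(\<lambda>x. INF g\<in>{f, \<lambda>x. c}. g x) \<in> M"
    using assms M_const by (intro M_INF) auto
  moreover have "(INF g\<in>{f, \<lambda>x. c}. g x) = min (f x) c" for x
    by (simp add: cInf_insert_If inf_min)
  ultimately show ?thesis by simp
qed

lemma metric_of_upper:
  assumes "f \<in> M"
  shows "ennreal (f x - f y) \<le> metric_of M x y"
proof -
  have "(\<lambda>x. f x + (- f y)) \<in> M" using assms by (rule M_add)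
  then have "ennreal (f x + (- f y)) \<le> metric_of M x y"
    unfolding metric_of_def by (intro SUP_upper2[of "\<lambda>x. f x + (- f y)"]) auto
  then show ?thesis by simp
qed

lemma metric_of_pseudo_metric: "pseudo_metric (metric_of M)"
  unfolding pseudo_metric_def
proof (intro conjI allI)
  show "metric_of M x x = 0" for x
  proof -
    have "metric_of M x x \<le> 0" unfolding metric_of_def by (rule SUP_least) simp
    then show ?thesis by simp
  qed
  have sym: "metric_of M x y \<le> metric_of M y x" for x y
    unfolding metric_of_def[of M x y]
  proof (rule SUP_least)
    fix f assume "f \<in> {f \<in> M. f y = 0}"
    then show "ennreal (f x) \<le> metric_of M y x"
      using metric_of_upper[OF M_minus, of f y x] by simp
  qed
  show "metric_of M x y = metric_of M y x" for x y using sym by (intro antisym)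
  show "metric_of M x z \<le> metric_of M x y + metric_of M y z" for x y z
    unfolding metric_of_def[of M x z]
  proof (rule SUP_least)
    fix f assume f: "f \<in> {f \<in> M. f z = 0}"
    have "ennreal (f x) \<le> ennreal (f x - f y) + ennreal (f y - f z)"
    proof (cases "0 \<le> f x - f y \<and> 0 \<le> f y")
      case False
      then show ?thesis using f by (cases "f x \<le> f y") (auto intro: add_increasing add_increasing2 ennreal_leI)
    qed (use f in \<open>simp flip: ennreal_plus\<close>)
    also have "\<dots> \<le> metric_of M x y + metric_of M y z"
      using f by (intro add_mono metric_of_upper) auto
    finally show "ennreal (f x) \<le> metric_of M x y + metric_of M y z" .
  qed
qed

text \<open>
  First \<open>\<rho>(\<cdot>, y) \<and> T\<close> is the supremum of the functions \<open>f \<and> T\<close> with \<open>f \<in> M\<close> and \<open>f(y) = 0\<close>; then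
  \<open>\<rho>\<^sub>A \<and> T\<close> is the infimum of these over \<open>y \<in> A\<close>.  Only the empty set, for which the cut-off distance is
  the constant \<open>T\<close>, is special.
\<close>
lemma cut_in_M:
  assumes T: "0 < T"
  shows "pm_setdist_cut (metric_of M) A T \<in> M"
proof -
  define d where "d y x = enn2real (min (metric_of M x y) (ennreal T))" for y x
  have ed: "ennreal (d y x) = min (metric_of M x y) (ennreal T)" for x y
    unfolding d_def by (rule ennreal_enn2real) (simp add: min_less_iff_disj)
  have d0: "0 \<le> d y x" for x y by (simp add: d_def)
  have dM: "d y \<in> M" for y
  proof -
    define F where "F = (\<lambda>f x. min (f x) T) ` {f \<in> M. f y = 0}"
    have zero: "(\<lambda>x. 0) \<in> {f \<in> M. f y = 0}" using M_zero by simp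
    have F0: "(\<lambda>x. 0) \<in> F" unfolding F_def using T by (intro image_eqI[OF _ zero]) auto
    have bdd: "bdd_above ((\<lambda>f. f x) ` F)" for x by (rule bdd_aboveI[of _ T]) (auto simp: F_def)
    have FM: "F \<subseteq> M" unfolding F_def using M_min_const by auto
    have "(\<lambda>x. SUP f\<in>F. f x) \<in> M" using F0 FM bdd by (intro M_SUP) auto
    moreover have "(SUP f\<in>F. f x) = d y x" for x
    proof (rule antisym)
      show "(SUP f\<in>F. f x) \<le> d y x"
      proof (rule cSUP_least)
        fix g assume "g \<in> F"
        then obtain f where f: "f \<in> M" "f y = 0" "g = (\<lambda>x. min (f x) T)" by (auto simp: F_def)
        have "ennreal (g x) \<le> ennreal (d y x)"
          unfolding ed
        proof (rule min.boundedI)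
          have "ennreal (g x) \<le> ennreal (f x - f y)" using f(2,3) by (intro ennreal_leI) simp
          also have "\<dots> \<le> metric_of M x y" by (rule metric_of_upper[OF f(1)])
          finally show "ennreal (g x) \<le> metric_of M x y" .
          show "ennreal (g x) \<le> ennreal T" using f(3) by (intro ennreal_leI) simp
        qed
        then show "g x \<le> d y x" using d0 by (simp add: ennreal_le_iff)
      qed (use F0 in auto)
      have s0: "0 \<le> (SUP f\<in>F. f x)" using cSUP_upper[OF F0 bdd[of x]] by simp
      show "d y x \<le> (SUP f\<in>F. f x)"
      proof (rule ccontr)
        assume "\<not> ?thesis"
        then have less: "ennreal (SUP f\<in>F. f x) < min (metric_of M x y) (ennreal T)"
          using s0 by (simp add: ed[symmetric] ennreal_less_iff)
        then obtain f where f: "f \<in> M" "f y = 0" "ennreal (SUP f\<in>F. f x) < ennreal (f x)"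
          unfolding metric_of_def by (auto simp: less_SUP_iff)
        have "(SUP f\<in>F. f x) < min (f x) T" using f(3) less s0 by (simp add: ennreal_less_iff)
        moreover have "min (f x) T \<le> (SUP f\<in>F. f x)"
          using cSUP_upper[OF _ bdd[of x], of "\<lambda>x. min (f x) T"] f(1,2) by (auto simp: F_def)
        ultimately show False by linarith
      qed
    qed
    ultimately show ?thesis by simp
  qed
  show ?thesis
  proof (cases "A = {}")
    case True
    have "pm_setdist_cut (metric_of M) A T = (\<lambda>x. T)"
      using T True by (simp add: pm_setdist_cut_def pm_setdist_def fun_eq_iff)
    then show ?thesis using M_const by simp
  next
    case False
    have bdd: "bdd_below ((\<lambda>f. f x) ` d ` A)" for x using d0 by (intro bdd_belowI[of _ 0]) auto
    have "(\<lambda>x. INF f\<in>d ` A. f x) \<in> M" using False dM bdd by (intro M_INF) auto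
    moreover have "(INF f\<in>d ` A. f x) = pm_setdist_cut (metric_of M) A T x" for x
    proof -
      let ?p = "pm_setdist_cut (metric_of M) A T x"
      have ep: "ennreal ?p = min (INF y\<in>A. metric_of M x y) (ennreal T)"
        unfolding pm_setdist_cut_def pm_setdist_def
        by (rule ennreal_enn2real) (simp add: min_less_iff_disj)
      have p0: "0 \<le> ?p" by (simp add: pm_setdist_cut_def)
      show ?thesis
      proof (rule antisym)
        have i0: "0 \<le> (INF f\<in>d ` A. f x)" using False d0 by (intro cINF_greatest) auto
        have "ennreal (INF f\<in>d ` A. f x) \<le> ennreal ?p"
          unfolding ep
        proof (intro min.boundedI INF_greatest)
          have le: "ennreal (INF f\<in>d ` A. f x) \<le> min (metric_of M x y) (ennreal T)" if "y \<in> A" for y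
            unfolding ed[symmetric] using that bdd by (intro ennreal_leI cINF_lower) auto
          show "ennreal (INF f\<in>d ` A. f x) \<le> metric_of M x y" if "y \<in> A" for y using le[OF that] by simp
          show "ennreal (INF f\<in>d ` A. f x) \<le> ennreal T" using False le by fastforce
        qed
        then show "(INF f\<in>d ` A. f x) \<le> ?p" using p0 by (simp add: ennreal_le_iff)
        show "?p \<le> (INF f\<in>d ` A. f x)"
        proof (rule cINF_greatest)
          fix f assume "f \<in> d ` A"
          then obtain y where y: "y \<in> A" "f = d y" by auto
          have "ennreal ?p \<le> ennreal (d y x)"
            unfolding ep ed using y(1) by (intro min.mono INF_lower order_refl)
          then show "?p \<le> f x" using d0 y(2) by (simp add: ennreal_le_iff)
        qed (use False in auto)
      qed
    qed
    ultimately show ?thesis by simp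
  qed
qed

lemma metric_of_intrinsic_metric: "intrinsic_metric m D E J \<mu>c (metric_of M)"
proof -
  have "\<exists>mb mc. admissible_pair m mb mc \<and> (\<forall>f\<in>M. energy_bounded m D E J \<mu>c mb mc f)"
    using function_axioms unfolding intrinsic_metric_functions_def by (elim conjE)
  then obtain mb mc where "admissible_pair m mb mc" "\<forall>f\<in>M. energy_bounded m D E J \<mu>c mb mc f"
    by (elim exE conjE)
  then show ?thesis
    unfolding intrinsic_metric_def
    using metric_of_pseudo_metric cut_in_M M_D_loc_star M_continuous by blast
qed

end

theorem theorem5p3:
  fixes m k :: "'a::{metric_space, second_countable_topology} measure"
    and D :: "('a \<Rightarrow> real) set"
    and E :: "('a \<Rightarrow> real) \<Rightarrow> ('a \<Rightarrow> real) \<Rightarrow> real"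
    and J :: "('a \<times> 'a) measure"
    and \<mu>c :: "('a \<Rightarrow> real) \<Rightarrow> ('a \<Rightarrow> real) \<Rightarrow> 'a set \<Rightarrow> real"
  assumes "locally compact (UNIV :: 'a set)"
    and "radon_measure m" and "full_support m"
    and "regular_dirichlet_form m D E"
    and "beurling_deny m D E J k \<mu>c"
  shows "(\<forall>\<rho>. intrinsic_metric m D E J \<mu>c \<rho> \<longrightarrow>
            intrinsic_metric_functions m D E J \<mu>c {f. \<forall>x y. ennreal \<bar>f x - f y\<bar> \<le> \<rho> x y} \<and>
            metric_of {f. \<forall>x y. ennreal \<bar>f x - f y\<bar> \<le> \<rho> x y} = \<rho>) \<and>
         (\<forall>M. intrinsic_metric_functions m D E J \<mu>c M \<longrightarrow>
            intrinsic_metric m D E J \<mu>c (metric_of M))"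
proof (intro conjI allI impI)
  fix \<rho> assume "intrinsic_metric m D E J \<mu>c \<rho>"
  then obtain mb mc where \<rho>: "pseudo_metric \<rho>" "admissible_pair m mb mc"
    "\<forall>A. \<forall>T>0. pm_setdist_cut \<rho> A T \<in> D_loc_star m D E J \<and>
           continuous_on UNIV (pm_setdist_cut \<rho> A T) \<and>
           energy_bounded m D E J \<mu>c mb mc (pm_setdist_cut \<rho> A T)"
    unfolding intrinsic_metric_def by (elim exE conjE)
  interpret intrinsic_metric_form m k D E J \<mu>c \<rho> mb mc
    using assms \<rho> by unfold_locales simp_all
  show "intrinsic_metric_functions m D E J \<mu>c {f. \<forall>x y. ennreal \<bar>f x - f y\<bar> \<le> \<rho> x y}"
    by (rule Lip_intrinsic_metric_functions)
  show "metric_of {f. \<forall>x y. ennreal \<bar>f x - f y\<bar> \<le> \<rho> x y} = \<rho>"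
    by (rule metric_of_Lip)
next
  fix M assume "intrinsic_metric_functions m D E J \<mu>c M"
  then interpret intrinsic_functions m D E J \<mu>c M by unfold_locales
  show "intrinsic_metric m D E J \<mu>c (metric_of M)" by (rule metric_of_intrinsic_metric)
qed

end
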